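(* Assume Assumptions 1 and 2, fix $T\ge1$, and let $\pi_0$ either admit a density or be a point mass $\delta_{x_0}$. Set $J^T_T\equiv0$ and for $t=T-1,\dots,0$ define $$J^T_t(\pi)=\inf_{Q\in\mathcal Q_c}\Big(\tfrac1T c(\pi,Q)+\sum_{m=1}^M J^T_{t+1}\big(\hat\pi(m,\pi,Q)\big)\,\pi(Q^{-1}(m))\Big),$$ (terms with $\pi(Q^{-1}(m))=0$ being zero). Then for every $t\ge1$ and $\pi\in\mathcal S$, and for $t=0$ and $\pi\in\mathcal S\cup\{\pi_0\}$, the infimum is attained by some $Q\in\mathcal Q_c$. Moreover, $J^T_t$ is continuous on $\mathcal S$.
   Context: Assumption 1: the source is $x_{t+1}=f(x_t,w_t)$ with $f:\mathbb R^d\times\mathbb R^d\to\mathbb R^d$ Borel, $\{w_t\}$ i.i.d. and independent of $x_0\sim\pi_0$; for each $x$ the law of $f(x,w_0)$ has a density $\phi(\cdot|x)$ which is strictly positive everywhere, bounded by $C$ and $C_1$-Lipschitz, uniformly in $x$. Assumption 2: $c_0:\mathbb R^d\times\mathbb U\to\mathbb R$ is nonnegative, bounded and continuous, and the reconstruction set $\mathbb U$ is compact. $\mathcal S$: probability measures on $\mathbb R^d$ with density bounded by $C$ and $C_1$-Lipschitz, with the weak (equivalently, total variation) topology. $M$-cell quantizer: Borel $Q:\mathbb R^d\to\{1,\dots,M\}$; $\mathcal Q_c$: quantizers with all cells $Q^{-1}(i)$ convex, topologized by: fix $P$ with strictly positive density, identify $Q,Q'$ if $PQ=PQ'$, and $Q_n\to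 Q$ iff $PQ_n\to PQ$ weakly, where $PQ(A\times\{i\})=P(A\cap Q^{-1}(i))$. Cost: $c(\pi,Q)=\sum_{i=1}^M\inf_{u\in\mathbb U}\int_{Q^{-1}(i)}c_0(x,u)\pi(dx)$. Filter update: $\hat\pi(m,\pi,Q)$ is the probability measure with density $z\mapsto\pi(Q^{-1}(m))^{-1}\int_{Q^{-1}(m)}\phi(z|x)\pi(dx)$ when $\pi(Q^{-1}(m))>0$. *)

theory Defs
  imports "HOL-Probability.Probability"
begin

text \<open>The state space R^d is modelled by an arbitrary Euclidean space type 'a.
  Probability measures on R^d are values of type 'a measure.\<close>

definition dens_class :: "real \<Rightarrow> real \<Rightarrow> ('a::euclidean_space) measure set" where
  "dens_class C C1 = {\<pi>. prob_space \<pi> \<and>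
     (\<exists>g. g \<in> borel_measurable borel \<and> \<pi> = density lborel (\<lambda>x. ennreal (g x)) \<and>
          (\<forall>x. 0 \<le> g x \<and> g x \<le> C) \<and> (\<forall>x y. \<bar>g x - g y\<bar> \<le> C1 * dist x y))}"

definition weak_conv_seq :: "(nat \<Rightarrow> ('a::euclidean_space) measure) \<Rightarrow> 'a measure \<Rightarrow> bool" where
  "weak_conv_seq \<mu>s \<mu> \<longleftrightarrow>
     (\<forall>g::'a \<Rightarrow> real. continuous_on UNIV g \<and> bounded (range g) \<longrightarrow>
        (\<lambda>n. \<integral>x. g x \<partial>(\<mu>s n)) \<longlonglongrightarrow> (\<integral>x. g x \<partial>\<mu>))"

definition quantizers_c :: "nat \<Rightarrow> (('a::euclidean_space) \<Rightarrow> nat) set" where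
  "quantizers_c M = {Q. Q \<in> borel_measurable borel \<and> (\<forall>x. Q x \<in> {1..M}) \<and>
                        (\<forall>i\<in>{1..M}. convex (Q -` {i}))}"

definition qcost :: "nat \<Rightarrow> ('a::euclidean_space \<Rightarrow> 'u \<Rightarrow> real) \<Rightarrow> 'u set \<Rightarrow> 'a measure \<Rightarrow> ('a \<Rightarrow> nat) \<Rightarrow> real" where
  "qcost M c0 U \<pi> Q = (\<Sum>i=1..M. INF u\<in>U. \<integral>x. indicator (Q -` {i}) x * c0 x u \<partial>\<pi>)"

text \<open>Filter update; phi x z is the transition density phi(z|x).\<close>
definition filter_update :: "('a::euclidean_space \<Rightarrow> 'a \<Rightarrow> real) \<Rightarrow> nat \<Rightarrow> 'a measure \<Rightarrow> ('a \<Rightarrow> nat) \<Rightarrow> 'a measure" where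
  "filter_update \<phi> m \<pi> Q = density lborel
     (\<lambda>z. ennreal ((\<integral>x. indicator (Q -` {m}) x * \<phi> x z \<partial>\<pi>) / measure \<pi> (Q -` {m})))"

definition stage_obj :: "nat \<Rightarrow> ('a::euclidean_space \<Rightarrow> 'u \<Rightarrow> real) \<Rightarrow> 'u set \<Rightarrow> ('a \<Rightarrow> 'a \<Rightarrow> real) \<Rightarrow> nat
    \<Rightarrow> ('a measure \<Rightarrow> real) \<Rightarrow> 'a measure \<Rightarrow> ('a \<Rightarrow> nat) \<Rightarrow> real" where
  "stage_obj M c0 U \<phi> T Jn \<pi> Q =
     (1 / real T) * qcost M c0 U \<pi> Q +
     (\<Sum>m=1..M. if measure \<pi> (Q -` {m}) = 0 then 0
                 else Jn (filter_update \<phi> m \<pi> Q) * measure \<pi> (Q -` {m}))"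

primrec Jrem :: "nat \<Rightarrow> ('a::euclidean_space \<Rightarrow> 'u \<Rightarrow> real) \<Rightarrow> 'u set \<Rightarrow> ('a \<Rightarrow> 'a \<Rightarrow> real) \<Rightarrow> nat
    \<Rightarrow> nat \<Rightarrow> 'a measure \<Rightarrow> real" where
  "Jrem M c0 U \<phi> T 0 = (\<lambda>\<pi>. 0)"
| "Jrem M c0 U \<phi> T (Suc n) =
     (\<lambda>\<pi>. INF Q\<in>quantizers_c M. stage_obj M c0 U \<phi> T (Jrem M c0 U \<phi> T n) \<pi> Q)"

definition JT :: "nat \<Rightarrow> ('a::euclidean_space \<Rightarrow> 'u \<Rightarrow> real) \<Rightarrow> 'u set \<Rightarrow> ('a \<Rightarrow> 'a \<Rightarrow> real) \<Rightarrow> nat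
    \<Rightarrow> nat \<Rightarrow> 'a measure \<Rightarrow> real" where
  "JT M c0 U \<phi> T t = Jrem M c0 U \<phi> T (T - t)"

end

theory Submission
  imports Defs
begin

text \<open>
  The key point is a compactness property of quantizers with convex cells: every sequence of them has a
  subsequence that converges pointwise at \<^emph>\<open>every\<close> point, so that the limit is automatically Borel with convex
  cells. By dominated convergence the stage cost and the filter update are then jointly continuous in
  the quantizer and in the measure, the latter with respect to total variation, and minimising sequences
  give optimal quantizers for every Borel probability measure. On the class \<open>\<S>\<close> weak convergence forces
  pointwise convergence of the equi-Lipschitz densities, hence convergence in total variation by Scheffe's
  lemma, and backward induction gives continuity of the value functions.
\<close>

section \<open>Compactness of convex quantizers\<close>

text \<open>Convergence of the quantizers at almost every point would be too weak:
  \<open>\<pi>0\<close> may be a point mass sitting on the boundary between limiting cells. There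
  the limiting hyperplane leaves the label undetermined, so the extraction is repeated inside each
  hyperplane, by induction on the dimension. Total variation is the right mode for the measures
  because cell indicators are discontinuous and change together with the measure. Two more obstacles
  shape the argument. The stage cost contains an infimum over \<open>U\<close>, so integrals must
  converge uniformly over a family of integrands. The posterior of a cell whose probability tends to
  0 need not converge, so the induction carries a bound on the value function besides its
  continuity. The recursion closes because the posterior density is an average of the densities
  \<open>\<phi> x\<close> and inherits the constants \<open>C\<close> and \<open>C1\<close> from
  them, whatever the prior.\<close>

text \<open>Successive extraction, one index at a time; heredity under passing to subsequences keeps
  the properties secured earlier. It is applied to the pairs of distinct labels, for the convergence
  of the normals and for the induction hypotheses on the limiting hyperplanes.\<close>

lemma finite_common_subsequence:
  fixes P :: "'i \<Rightarrow> (nat \<Rightarrow> nat) \<Rightarrow> bool"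
  assumes "finite I"
    and ex: "\<And>i (r :: nat \<Rightarrow> nat). i \<in> I \<Longrightarrow> strict_mono r \<Longrightarrow> \<exists>r'. strict_mono r' \<and> P i (r \<circ> r')"
    and sub: "\<And>i r (r' :: nat \<Rightarrow> nat). i \<in> I \<Longrightarrow> P i r \<Longrightarrow> strict_mono r' \<Longrightarrow> P i (r \<circ> r')"
  shows "\<exists>r. strict_mono r \<and> (\<forall>i\<in>I. P i r)"
  using assms
proof (induction I rule: finite_induct)
  case empty
  show ?case using strict_mono_id by blast
next
  case (insert k I)
  have "\<exists>r. strict_mono r \<and> (\<forall>i\<in>I. P i r)"
    by (rule insert.IH) (rule insert.prems, simp, assumption+)+
  then obtain r where r: "strict_mono r" "\<forall>i\<in>I. P i r"
    by blast
  obtain r' where r': "strict_mono r'" "P k (r \<circ> r')"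
    using insert.prems(1)[OF insertI1 r(1)] by blast
  have "\<forall>i\<in>insert k I. P i (r \<circ> r')"
    using r r' insert.prems(2)[OF _ _ r'(1), of _ r] by (metis insertE)
  then show ?case using strict_mono_o[OF r(1) r'(1)] by blast
qed

text \<open>With \<open>w = u * s + v * t\<close>, the combination of \<open>s *\<^sub>R p\<close>
  and \<open>t *\<^sub>R q\<close> is \<open>w\<close> times a convex combination of
  \<open>p\<close> and \<open>q\<close>. The factor 0 is excluded so that cones over disjoint sets
  at height 1 stay disjoint.\<close>

lemma convex_open_cone:
  fixes S :: "'b::real_vector set"
  assumes "convex S"
  shows "convex {s *\<^sub>R p |s p. 0 < s \<and> p \<in> S}"
proof (rule convexI)
  fix x y and u v :: real
  assume "x \<in> {s *\<^sub>R p |s p. 0 < s \<and> p \<in> S}" "y \<in> {s *\<^sub>R p |s p. 0 < s \<and> p \<in> S}"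
    and uv: "0 \<le> u" "0 \<le> v" "u + v = 1"
  then obtain s p t q where s: "0 < s" "p \<in> S" "x = s *\<^sub>R p" and t: "0 < t" "q \<in> S" "y = t *\<^sub>R q"
    by blast
  define w where "w = u * s + v * t"
  have w: "0 < w"
    unfolding w_def using uv s t
    by (smt (verit) mult_nonneg_nonneg mult_pos_pos)
  have "(u * s / w) *\<^sub>R p + (v * t / w) *\<^sub>R q \<in> S"
    using uv s t w by (intro convexD[OF assms]) (auto simp: w_def simp flip: add_divide_distrib)
  moreover have "u *\<^sub>R x + v *\<^sub>R y = w *\<^sub>R ((u * s / w) *\<^sub>R p + (v * t / w) *\<^sub>R q)"
    using w by (simp add: s t scaleR_add_right)
  ultimately show "u *\<^sub>R x + v *\<^sub>R y \<in> {s *\<^sub>R p |s p. 0 < s \<and> p \<in> S}"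
    using w by blast
qed

lemma separating_unit_normal_in_subspace:
  fixes S T V :: "'b::euclidean_space set"
  assumes "convex S" "convex T" "S \<inter> T = {}" "S \<subseteq> V" "T \<subseteq> V" "subspace V" "V \<noteq> {0}"
    and height: "\<And>x. x \<in> S \<union> T \<Longrightarrow> e \<bullet> x = 1"
  shows "\<exists>v\<in>V. norm v = 1 \<and> (\<forall>x\<in>S. 0 \<le> v \<bullet> x) \<and> (\<forall>x\<in>T. v \<bullet> x \<le> 0)"
proof -
  have *: "\<exists>a\<in>V. a \<noteq> 0 \<and> (\<forall>x\<in>D. 0 \<le> a \<bullet> x)" if "convex D" "0 \<notin> D" "D \<subseteq> V" for D
  proof (cases "D = {}")
    case True
    \<comment> \<open>With no points to bound, any nonzero vector of \<open>V\<close>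
      serves.\<close>
    then show ?thesis using \<open>V \<noteq> {0}\<close> subspace_0[OF \<open>subspace V\<close>] by auto
  next
    case False
    have "span D \<subseteq> V" using that \<open>subspace V\<close> by (simp add: span_minimal)
    moreover obtain a where a: "a \<in> span D" "a \<noteq> 0" "\<forall>x\<in>D. 0 \<le> a \<bullet> x"
      using separating_hyperplane_set_0_inspan[OF \<open>convex D\<close> False \<open>0 \<notin> D\<close>] by metis
    ultimately show ?thesis by blast
  qed
  have "\<exists>a\<in>V. a \<noteq> 0 \<and> (\<forall>x\<in>S. 0 \<le> a \<bullet> x) \<and> (\<forall>x\<in>T. a \<bullet> x \<le> 0)"
  proof -
    consider "S = {}" | "T = {}" | "S \<noteq> {}" "T \<noteq> {}" by blast
    then show ?thesis
    proof cases
      case 1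
      have "0 \<notin> T" using height[of 0] by auto
      then obtain a where "a \<in> V" "a \<noteq> 0" "\<forall>x\<in>T. 0 \<le> a \<bullet> x" using *[of T] assms by blast
      then show ?thesis using 1 subspace_neg[OF \<open>subspace V\<close>]
        by (intro bexI[of _ "- a"]) auto
    next
      case 2
      have "0 \<notin> S" using height[of 0] by auto
      then show ?thesis using *[of S] assms 2 by blast
    next
      case 3
      define K where "K X = {s *\<^sub>R p |s p. 0 < s \<and> p \<in> X}" for X :: "'b set"
      define D where "D = {x - y |x y. x \<in> K S \<and> y \<in> K T}"
      have "convex D"
      proof -
        have "D = (\<Union>x\<in>K S. \<Union>y\<in>K T. {x - y})" by (auto simp: D_def)
        then show ?thesis
          using convex_differences[of "K S" "K T"] convex_open_cone[OF assms(1)] convex_open_cone[OF assms(2)]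
          by (simp add: K_def)
      qed
      moreover have "0 \<notin> D"
      proof
        assume "0 \<in> D"
        \<comment> \<open>Since \<open>e\<close> equals 1 on both sets, it reads off the scales from
          a common point of the two cones; they coincide, and so do \<open>p\<close> and
          \<open>q\<close>, against disjointness.\<close>
        then obtain s p t q where pq: "0 < s" "p \<in> S" "0 < t" "q \<in> T" "s *\<^sub>R p = t *\<^sub>R q"
          by (auto simp: D_def K_def)
        have "e \<bullet> (s *\<^sub>R p) = s" "e \<bullet> (t *\<^sub>R q) = t"
          using height[of p] height[of q] pq(2,4) by auto
        then have "s = t" using pq(5) by simp
        then have "p = q" using pq by simp
        then show False using pq assms(3) by blast
      qed
      moreover have "D \<subseteq> V"
      proof
        fix x assume "x \<in> D"
        then obtain s p t q where "p \<in> S" "q \<in> T" "x = s *\<^sub>R p - t *\<^sub>R q"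
          by (auto simp: D_def K_def)
        then show "x \<in> V"
          using assms(4-6) by (simp add: subsetD subspace_diff subspace_scale)
      qed
      ultimately have "\<exists>a\<in>V. a \<noteq> 0 \<and> (\<forall>x\<in>D. 0 \<le> a \<bullet> x)"
        by (rule *)
      then obtain a where a: "a \<in> V" "a \<noteq> 0" "\<And>x. x \<in> D \<Longrightarrow> 0 \<le> a \<bullet> x"
        by blast
      have ineq: "t * (a \<bullet> q) \<le> s * (a \<bullet> p)" if "0 < s" "p \<in> S" "0 < t" "q \<in> T" for s p t q
      proof -
        have "s *\<^sub>R p - t *\<^sub>R q \<in> D" using that by (auto simp: D_def K_def)
        from a(3)[OF this] show ?thesis by (simp add: inner_diff_right)
      qed
      have S0: "0 \<le> a \<bullet> p" if p: "p \<in> S" for p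
      proof (rule ccontr)
        obtain q where q: "q \<in> T" using 3 by blast
        assume n: "\<not> 0 \<le> a \<bullet> p"
        \<comment> \<open>A negative value on the cone over \<open>S\<close> could be scaled down
          arbitrarily; this factor brings it to \<open>- (\<bar>a \<bullet> q\<bar> + 1)\<close>,
          below \<open>a \<bullet> q\<close>. The factor \<open>t\<close> further down plays the
          mirrored role.\<close>
        define s where "s = (\<bar>a \<bullet> q\<bar> + 1) / - (a \<bullet> p)"
        have "0 < s" using n by (simp add: s_def divide_pos_neg)
        moreover have "s * (a \<bullet> p) = - (\<bar>a \<bullet> q\<bar> + 1)" using n by (simp add: s_def)
        ultimately show False using ineq[of s p 1 q] p q by simp
      qed
      have T0: "a \<bullet> q \<le> 0" if q: "q \<in> T" for q
      proof (rule ccontr)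
        obtain p where p: "p \<in> S" using 3 by blast
        assume n: "\<not> a \<bullet> q \<le> 0"
        define t where "t = (\<bar>a \<bullet> p\<bar> + 1) / (a \<bullet> q)"
        have "0 < t" using n by (simp add: t_def)
        moreover have "t * (a \<bullet> q) = \<bar>a \<bullet> p\<bar> + 1" using n by (simp add: t_def)
        ultimately show False using ineq[of 1 p t q] p q by simp
      qed
      show ?thesis using a S0 T0 by blast
    qed
  qed
  then obtain a where a: "a \<in> V" "a \<noteq> 0" "\<forall>x\<in>S. 0 \<le> a \<bullet> x" "\<forall>x\<in>T. a \<bullet> x \<le> 0" by blast
  have "inverse (norm a) *\<^sub>R a \<in> V" using a \<open>subspace V\<close> by (simp add: subspace_scale)
  moreover have "norm (inverse (norm a) *\<^sub>R a) = 1" using a by simp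
  moreover have "\<forall>x\<in>S. 0 \<le> (inverse (norm a) *\<^sub>R a) \<bullet> x" using a by simp
  moreover have "\<forall>x\<in>T. (inverse (norm a) *\<^sub>R a) \<bullet> x \<le> 0"
    using a by (simp add: mult_nonneg_nonpos)
  ultimately show ?thesis by blast
qed

text \<open>By the pigeonhole principle some value is taken infinitely often; exclusivity against it
  then rules out every other value from some index on.\<close>

lemma eventually_const_if_pairwise_exclusive:
  assumes "finite A" "\<And>n. s n \<in> A"
    and excl: "\<And>i j. i \<in> A \<Longrightarrow> j \<in> A \<Longrightarrow> i \<noteq> j \<Longrightarrow>
      (\<forall>\<^sub>F n in sequentially. s n \<noteq> i) \<or> (\<forall>\<^sub>F n in sequentially. s n \<noteq> j)"
  shows "\<exists>i. \<forall>\<^sub>F n in sequentially. s n = i"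
proof -
  have "\<exists>i\<in>A. \<not> (\<forall>\<^sub>F n in sequentially. s n \<noteq> i)"
  proof (rule ccontr)
    assume "\<not> ?thesis"
    then have "\<forall>\<^sub>F n in sequentially. \<forall>i\<in>A. s n \<noteq> i"
      using assms(1) by (intro eventually_ball_finite) auto
    then have "\<forall>\<^sub>F n in sequentially. False"
      by (rule eventually_mono) (use assms(2) in blast)
    then show False by simp
  qed
  then obtain i where i: "i \<in> A" "\<not> (\<forall>\<^sub>F n in sequentially. s n \<noteq> i)" by blast
  have "\<forall>\<^sub>F n in sequentially. \<forall>j\<in>A - {i}. s n \<noteq> j"
    using assms(1) i excl by (intro eventually_ball_finite) auto
  then have "\<forall>\<^sub>F n in sequentially. s n = i"
    by (rule eventually_mono) (use assms(2) in auto)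
  then show ?thesis by blast
qed

text \<open>A point \<open>x\<close> is encoded as \<open>(x, 1)\<close>, so that affine subspaces become linear ones. Cells \<open>i\<close> and \<open>j\<close> of the
  \<open>n\<close>-th quantizer are separated by a unit normal; along a subsequence these normals converge. Off the limiting
  hyperplanes the cell of a point is eventually constant, and on them the dimension has dropped by one.\<close>

lemma convex_cells_subsequence_on_subspace:
  fixes Q :: "nat \<Rightarrow> 'a::euclidean_space \<Rightarrow> nat" and V :: "('a \<times> real) set"
  assumes "subspace V" and range: "\<And>n x. Q n x \<in> {1..M}"
    and conv: "\<And>n i. i \<in> {1..M} \<Longrightarrow> convex (Q n -` {i})"
  shows "\<exists>r. strict_mono r \<and> (\<forall>x. (x, 1) \<in> V \<longrightarrow> (\<exists>i. \<forall>\<^sub>F n in sequentially. Q (r n) x = i))"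
  using assms
proof (induction "dim V" arbitrary: V Q rule: less_induct)
  case less
  note range = less.prems(2) and conv = less.prems(3) and V = less.prems(1)
  show ?case
  proof (cases "V = {0}")
    case True
    \<comment> \<open>The base of the induction is vacuous: no encoded point \<open>(x, 1)\<close>
      is the origin.\<close>
    then show ?thesis using strict_mono_id by (auto simp: zero_prod_def)
  next
    case False
    define cell where "cell n i = {(x, 1::real) |x. Q n x = i \<and> (x, 1) \<in> V}" for n i
    have cell_convex: "convex (cell n i)" if "i \<in> {1..M}" for n i
    proof -
      have "cell n i = (Q n -` {i} \<times> {1}) \<inter> V" by (auto simp: cell_def)
      then show ?thesis
        using conv[OF that] V by (simp add: convex_Int convex_Times subspace_imp_convex)
    qed
    \<comment> \<open>The vector \<open>(0, 1)\<close> picks the last coordinate, which is 1 on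
      every encoded point.\<close>
    have "\<exists>v\<in>V. norm v = 1 \<and> (\<forall>x\<in>cell n i. 0 \<le> v \<bullet> x) \<and> (\<forall>x\<in>cell n j. v \<bullet> x \<le> 0)"
      if "i \<in> {1..M}" "j \<in> {1..M}" "i \<noteq> j" for n i j
      using that V False cell_convex
      by (intro separating_unit_normal_in_subspace[where e = "(0, 1)"]) (auto simp: cell_def)
    then have "\<forall>n i j. \<exists>v. i \<in> {1..M} \<longrightarrow> j \<in> {1..M} \<longrightarrow> i \<noteq> j \<longrightarrow>
        v \<in> V \<and> norm v = 1 \<and> (\<forall>x\<in>cell n i. 0 \<le> v \<bullet> x) \<and> (\<forall>x\<in>cell n j. v \<bullet> x \<le> 0)"
      by blast
    then obtain v where v: "\<And>n i j. i \<in> {1..M} \<Longrightarrow> j \<in> {1..M} \<Longrightarrow> i \<noteq> j \<Longrightarrow>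
        v n i j \<in> V \<and> norm (v n i j) = 1 \<and> (\<forall>x\<in>cell n i. 0 \<le> v n i j \<bullet> x) \<and> (\<forall>x\<in>cell n j. v n i j \<bullet> x \<le> 0)"
      unfolding choice_iff by blast
    define I where "I = {(i, j). i \<in> {1..M} \<and> j \<in> {1..M} \<and> i \<noteq> j}"
    have "finite I" by (rule finite_subset[of _ "{1..M} \<times> {1..M}"]) (auto simp: I_def)
    have cpt: "compact (V \<inter> sphere 0 1)"
      using V by (intro closed_Int_compact closed_subspace) auto
    have "\<exists>r. strict_mono r \<and> (\<forall>p\<in>I. \<exists>l\<in>V \<inter> sphere 0 1. (\<lambda>n. v (r n) (fst p) (snd p)) \<longlonglongrightarrow> l)"
    proof (rule finite_common_subsequence[OF \<open>finite I\<close>])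
      fix p and r :: "nat \<Rightarrow> nat" assume "p \<in> I"
      then have "\<forall>n. v (r n) (fst p) (snd p) \<in> V \<inter> sphere 0 1"
        using v by (auto simp: I_def)
      then show "\<exists>r'. strict_mono r' \<and> (\<exists>l\<in>V \<inter> sphere 0 1. (\<lambda>n. v ((r \<circ> r') n) (fst p) (snd p)) \<longlonglongrightarrow> l)"
        using cpt[unfolded compact_def, rule_format, of "\<lambda>n. v (r n) (fst p) (snd p)"]
        by (auto simp: o_def)
    next
      fix p and r r' :: "nat \<Rightarrow> nat"
      assume "\<exists>l\<in>V \<inter> sphere 0 1. (\<lambda>n. v (r n) (fst p) (snd p)) \<longlonglongrightarrow> l" "strict_mono r'"
      then show "\<exists>l\<in>V \<inter> sphere 0 1. (\<lambda>n. v ((r \<circ> r') n) (fst p) (snd p)) \<longlonglongrightarrow> l"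
        using LIMSEQ_subseq_LIMSEQ[of "\<lambda>n. v (r n) (fst p) (snd p)" _ r'] unfolding o_def by blast
    qed
    then obtain r where r: "strict_mono r"
      and "\<forall>p\<in>I. \<exists>l\<in>V \<inter> sphere 0 1. (\<lambda>n. v (r n) (fst p) (snd p)) \<longlonglongrightarrow> l"
      by blast
    then obtain l where "\<forall>p\<in>I. l p \<in> V \<inter> sphere 0 1 \<and> (\<lambda>n. v (r n) (fst p) (snd p)) \<longlonglongrightarrow> l p"
      unfolding bchoice_iff Bex_def by blast
    then have l: "l p \<in> V \<and> norm (l p) = 1 \<and> (\<lambda>n. v (r n) (fst p) (snd p)) \<longlonglongrightarrow> l p"
      if "p \<in> I" for p
      using that by simp
    define H where "H p = {w\<in>V. l p \<bullet> w = 0}" for p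
    have "\<exists>r'. strict_mono r' \<and> (\<forall>p\<in>I. \<forall>x. (x, 1) \<in> H p \<longrightarrow> (\<exists>i. \<forall>\<^sub>F n in sequentially. Q (r (r' n)) x = i))"
    proof (rule finite_common_subsequence[OF \<open>finite I\<close>])
      fix p and s :: "nat \<Rightarrow> nat" assume p: "p \<in> I"
      have sub: "subspace (H p)"
        using V by (auto simp: H_def subspace_def inner_right_distrib)
      \<comment> \<open>The limit normal stays in \<open>V\<close> and keeps norm 1, so it is a
        vector of \<open>V\<close> not orthogonal to itself, and the dimension of \<open>H p\<close>
        is strictly smaller.\<close>
      have "l p \<notin> H p" using l[OF p] by (auto simp: H_def)
      then have "H p \<subset> V" using l[OF p] unfolding H_def by blast
      then have "dim (H p) < dim V"
        using sub V by (intro dim_psubset) (simp add: span_eq_iff[THEN iffD2])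
      from less.hyps[OF this sub, of "\<lambda>n. Q (r (s n))"] range conv
      show "\<exists>r'. strict_mono r' \<and> (\<forall>x. (x, 1) \<in> H p \<longrightarrow> (\<exists>i. \<forall>\<^sub>F n in sequentially. Q (r ((s \<circ> r') n)) x = i))"
        by auto
    next
      fix p and s s' :: "nat \<Rightarrow> nat"
      assume "\<forall>x. (x, 1) \<in> H p \<longrightarrow> (\<exists>i. \<forall>\<^sub>F n in sequentially. Q (r (s n)) x = i)" "strict_mono s'"
      then show "\<forall>x. (x, 1) \<in> H p \<longrightarrow> (\<exists>i. \<forall>\<^sub>F n in sequentially. Q (r ((s \<circ> s') n)) x = i)"
        using eventually_subseq[OF \<open>strict_mono s'\<close>] unfolding o_def by blast
    qed
    then obtain r' where r': "strict_mono r'"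
      and on_H: "\<And>p x. p \<in> I \<Longrightarrow> (x, 1) \<in> H p \<Longrightarrow> \<exists>i. \<forall>\<^sub>F n in sequentially. Q (r (r' n)) x = i"
      by blast
    have "\<exists>i. \<forall>\<^sub>F n in sequentially. Q (r (r' n)) x = i" if x: "(x, 1) \<in> V" for x
    proof (cases "\<exists>p\<in>I. (x, 1) \<in> H p")
      case True
      then show ?thesis using on_H by blast
    next
      case off: False
      show ?thesis
      proof (rule eventually_const_if_pairwise_exclusive[where A = "{1..M}"])
        fix i j assume ij: "i \<in> {1..M}" "j \<in> {1..M}" "i \<noteq> j"
        then have p: "(i, j) \<in> I" by (simp add: I_def)
        have "(\<lambda>n. v (r n) i j) \<longlonglongrightarrow> l (i, j)" using l[OF p] by simp
        from LIMSEQ_subseq_LIMSEQ[OF this r']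
        have lim: "(\<lambda>n. v (r (r' n)) i j \<bullet> (x, 1)) \<longlonglongrightarrow> l (i, j) \<bullet> (x, 1)"
          by (intro tendsto_intros) (simp add: o_def)
        have "l (i, j) \<bullet> (x, 1) \<noteq> 0" using off p x by (auto simp: H_def)
        \<comment> \<open>A nonzero limit fixes the sign of the products with the approximating
          normals from some index on, and this sign forbids one of the two cells.\<close>
        then consider "l (i, j) \<bullet> (x, 1) < 0" | "0 < l (i, j) \<bullet> (x, 1)" by linarith
        then show "(\<forall>\<^sub>F n in sequentially. Q (r (r' n)) x \<noteq> i) \<or> (\<forall>\<^sub>F n in sequentially. Q (r (r' n)) x \<noteq> j)"
        proof cases
          case 1
          have "\<forall>\<^sub>F n in sequentially. Q (r (r' n)) x \<noteq> i"
            using order_tendstoD(2)[OF lim 1]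
          proof eventually_elim
            case (elim n)
            have "(x, 1) \<notin> cell (r (r' n)) i" using v[OF ij] elim by (meson not_le)
            then show ?case using x by (auto simp: cell_def)
          qed
          then show ?thesis ..
        next
          case 2
          have "\<forall>\<^sub>F n in sequentially. Q (r (r' n)) x \<noteq> j"
            using order_tendstoD(1)[OF lim 2]
          proof eventually_elim
            case (elim n)
            have "(x, 1) \<notin> cell (r (r' n)) j" using v[OF ij] elim by (meson not_le)
            then show ?case using x by (auto simp: cell_def)
          qed
          then show ?thesis ..
        qed
      qed (use range in auto)
    qed
    then show ?thesis using strict_mono_o[OF r r'] by (auto intro!: exI[of _ "r \<circ> r'"])
  qed
qed

lemma quantizers_c_measurable:
  assumes "Q \<in> quantizers_c M"
  shows "Q \<in> borel \<rightarrow>\<^sub>M count_space UNIV"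
proof -
  have "Q \<in> borel_measurable borel" using assms unfolding quantizers_c_def by blast
  then show ?thesis by (simp add: measurable_cong_sets[OF refl sets_borel_eq_count_space])
qed

lemma quantizers_c_subsequence:
  fixes Q :: "nat \<Rightarrow> 'a::euclidean_space \<Rightarrow> nat"
  assumes Q: "\<And>n. Q n \<in> quantizers_c M"
  obtains r Q' where "strict_mono r" "Q' \<in> quantizers_c M"
    "\<And>x. \<forall>\<^sub>F n in sequentially. Q (r n) x = Q' x"
proof -
  have range: "Q n x \<in> {1..M}" for n x using Q unfolding quantizers_c_def by blast
  have conv: "convex (Q n -` {i})" if "i \<in> {1..M}" for n i
    using Q that unfolding quantizers_c_def by blast
  obtain r where r: "strict_mono r" "\<forall>x. \<exists>i. \<forall>\<^sub>F n in sequentially. Q (r n) x = i"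
    using convex_cells_subsequence_on_subspace[of UNIV Q M, OF subspace_UNIV range conv] by auto
  then obtain Q' where Q': "\<And>x. \<forall>\<^sub>F n in sequentially. Q (r n) x = Q' x" by metis
  have "Q' \<in> borel_measurable borel"
  proof -
    have real_meas: "(\<lambda>x. real (Q' x)) \<in> borel_measurable borel"
    proof (rule borel_measurable_LIMSEQ_real)
      show "(\<lambda>x. real (Q (r n) x)) \<in> borel_measurable borel" for n
      proof -
        have "Q (r n) \<in> borel \<rightarrow>\<^sub>M count_space UNIV" using Q by (rule quantizers_c_measurable)
        then show ?thesis by measurable
      qed
      show "(\<lambda>n. real (Q (r n) x)) \<longlonglongrightarrow> real (Q' x)" for x
        using Q'[of x] by (intro tendsto_eventually) (auto elim: eventually_mono)
    qed
    \<comment> \<open>The limit theorem is applied to real-valued labels; rounding down returns to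
      the natural numbers.\<close>
    have "Q' = (\<lambda>x. nat \<lfloor>real (Q' x)\<rfloor>)" by simp
    also have "\<dots> \<in> borel_measurable borel" using real_meas by measurable
    finally show ?thesis .
  qed
  moreover have "Q' x \<in> {1..M}" for x
  proof -
    obtain n where "Q (r n) x = Q' x"
      using eventually_happens[OF Q'] by auto
    then show ?thesis using range by metis
  qed
  moreover have "convex (Q' -` {i})" if "i \<in> {1..M}" for i
  proof (rule convexI)
    fix x y and u v :: real
    assume xy: "x \<in> Q' -` {i}" "y \<in> Q' -` {i}" and uv: "0 \<le> u" "0 \<le> v" "u + v = 1"
    have "\<forall>\<^sub>F n in sequentially. Q' (u *\<^sub>R x + v *\<^sub>R y) = i"
      \<comment> \<open>Convexity involves three points at a time, so at one late index all three
        labels agree with their limits.\<close>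
      using Q'[of x] Q'[of y] Q'[of "u *\<^sub>R x + v *\<^sub>R y"]
    proof eventually_elim
      case (elim n)
      then have "x \<in> Q (r n) -` {i}" "y \<in> Q (r n) -` {i}" using xy by auto
      from convexD[OF conv[OF that] this uv] show ?case using elim by simp
    qed
    then show "u *\<^sub>R x + v *\<^sub>R y \<in> Q' -` {i}" by simp
  qed
  ultimately have "Q' \<in> quantizers_c M" unfolding quantizers_c_def by blast
  then show thesis using that r(1) Q' by blast
qed

section \<open>Convergence in total variation\<close>

text \<open>For \<open>r > 0\<close> this is a bump supported in the closed ball of radius
  \<open>r\<close> about \<open>x\<close>. Being bounded and continuous in \<open>y\<close>, it is
  an admissible test function for weak convergence, and it recovers a Lipschitz density at
  \<open>x\<close> as \<open>r\<close> tends to 0.\<close>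

definition tent :: "real \<Rightarrow> 'a::euclidean_space \<Rightarrow> 'a \<Rightarrow> real" where
  "tent r x y = max 0 (1 - dist x y / r)"

lemma tent_nonneg: "0 \<le> tent r x y"
  by (simp add: tent_def)

lemma tent_le_1: "0 < r \<Longrightarrow> tent r x y \<le> 1"
  by (simp add: tent_def)

lemma tent_eq_0: "0 < r \<Longrightarrow> r \<le> dist x y \<Longrightarrow> tent r x y = 0"
  by (simp add: tent_def field_simps)

lemma continuous_on_tent: "continuous_on UNIV (tent r x)"
proof (cases "r = 0")
  case False
  then show ?thesis unfolding tent_def by (intro continuous_intros) auto
qed (simp add: tent_def)

lemma tent_measurable [measurable]: "(\<lambda>(x, y). tent r x y) \<in> borel_measurable (borel \<Otimes>\<^sub>M borel)"
  unfolding tent_def by measurable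

lemma integrable_tent_times:
  assumes r: "0 < r" and h [measurable]: "h \<in> borel_measurable borel" and B: "\<And>y. \<bar>h y\<bar> \<le> B"
  shows "integrable lborel (\<lambda>y. tent r x y * h y)"
proof (rule Bochner_Integration.integrable_bound[where f = "\<lambda>y. B * indicator (cball x r) y"])
  have "emeasure lborel (cball x r) < \<infinity>" by (rule emeasure_lborel_cball_finite)
  then show "integrable lborel (\<lambda>y. B * indicator (cball x r) y)"
    by (intro integrable_mult_right integrable_real_indicator) auto
  show "(\<lambda>y. tent r x y * h y) \<in> borel_measurable lborel" by measurable
  have "norm (tent r x y * h y) \<le> norm (B * indicator (cball x r) y)" for y
  proof (cases "dist x y \<le> r")
    case True
    have "tent r x y * \<bar>h y\<bar> \<le> 1 * B"
      using tent_le_1[OF r] tent_nonneg B[of y] by (intro mult_mono) auto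
    then show ?thesis using True by (simp add: abs_mult tent_nonneg)
  next
    case False
    then show ?thesis by (simp add: tent_eq_0[OF r])
  qed
  then show "AE y in lborel. norm (tent r x y * h y) \<le> norm (B * indicator (cball x r) y)" by simp
qed

lemma integrable_tent: "0 < r \<Longrightarrow> integrable lborel (tent r x)"
  using integrable_tent_times[of r "\<lambda>_. 1" 1 x] by simp

text \<open>The tent is at least 1/2 on the ball of radius \<open>r / 2\<close>, which has positive
  volume. This legitimates dividing by its integral.\<close>

lemma integral_tent_pos:
  fixes x :: "'a::euclidean_space"
  assumes r: "0 < r"
  shows "0 < (\<integral>y. tent r x y \<partial>lborel)"
proof -
  have "0 < measure lborel (ball x (r / 2)) / 2"
    using content_ball_pos[of "r / 2" x] r by simp
  also have "\<dots> = (\<integral>y. indicator (ball x (r / 2)) y / 2 \<partial>lborel)" by simp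
  also have "\<dots> \<le> (\<integral>y. tent r x y \<partial>lborel)"
  proof (rule integral_mono)
    have "emeasure lborel (ball x (r / 2)) < \<infinity>" by (rule emeasure_lborel_ball_finite)
    then show "integrable lborel (\<lambda>y. indicator (ball x (r / 2)) y / 2 :: real)"
      by (intro integrable_divide integrable_real_indicator) auto
    show "integrable lborel (tent r x)" by (rule integrable_tent[OF r])
    show "indicator (ball x (r / 2)) y / 2 \<le> tent r x y" for y
      using r by (auto simp: tent_def indicator_def field_simps)
  qed
  finally show ?thesis .
qed

text \<open>The weights live on points within distance \<open>r\<close> of \<open>x\<close>, where
  \<open>h\<close> deviates from \<open>h x\<close> by at most \<open>L * r\<close>. The bound
  \<open>B\<close> serves integrability and does not enter the estimate.\<close>

lemma tent_average_lipschitz: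
  assumes r: "0 < r" and h [measurable]: "h \<in> borel_measurable borel" and B: "\<And>y. \<bar>h y\<bar> \<le> B"
    and L: "0 \<le> L" "\<And>y. \<bar>h x - h y\<bar> \<le> L * dist x y"
  shows "\<bar>(\<integral>y. tent r x y * h y \<partial>lborel) / (\<integral>y. tent r x y \<partial>lborel) - h x\<bar> \<le> L * r"
proof -
  define m where "m = (\<integral>y. tent r x y \<partial>lborel)"
  have m: "0 < m" unfolding m_def by (rule integral_tent_pos[OF r])
  have "(\<integral>y. tent r x y * h y \<partial>lborel) - m * h x = (\<integral>y. tent r x y * h y - tent r x y * h x \<partial>lborel)"
    unfolding m_def using integrable_tent[OF r] integrable_tent_times[OF r h B]
    by (subst Bochner_Integration.integral_diff) auto
  also have "\<bar>\<dots>\<bar> \<le> (\<integral>y. tent r x y * (L * r) \<partial>lborel)"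
  proof (rule order_trans[OF integral_abs_bound integral_mono])
    show "integrable lborel (\<lambda>y. \<bar>tent r x y * h y - tent r x y * h x\<bar>)"
      using integrable_tent[OF r, of x] integrable_tent_times[OF r h B, of x]
      by (intro integrable_abs Bochner_Integration.integrable_diff) auto
    show "integrable lborel (\<lambda>y. tent r x y * (L * r))" using integrable_tent[OF r] by auto
    show "\<bar>tent r x y * h y - tent r x y * h x\<bar> \<le> tent r x y * (L * r)" for y
    proof (cases "dist x y \<le> r")
      case True
      have "\<bar>h y - h x\<bar> \<le> L * r"
        using L(2)[of y] mult_left_mono[OF True L(1)] by linarith
      then have "tent r x y * \<bar>h y - h x\<bar> \<le> tent r x y * (L * r)"
        by (intro mult_left_mono tent_nonneg)
      then show ?thesis by (simp add: abs_mult tent_nonneg flip: right_diff_distrib)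
    next
      case False
      then show ?thesis by (simp add: tent_eq_0[OF r])
    qed
  qed
  also have "\<dots> = m * (L * r)" by (simp add: m_def)
  finally have "\<bar>(\<integral>y. tent r x y * h y \<partial>lborel) - m * h x\<bar> \<le> m * (L * r)" .
  moreover have "(\<integral>y. tent r x y * h y \<partial>lborel) / m - h x = ((\<integral>y. tent r x y * h y \<partial>lborel) - m * h x) / m"
    using m by (simp add: field_simps)
  ultimately show ?thesis
    using m unfolding m_def[symmetric] by (simp add: pos_divide_le_eq mult.commute)
qed

section \<open>Total variation and densities\<close>

text \<open>The rate \<open>e\<close> is common to all Borel test functions bounded by 1. This
  uniformity allows test functions that vary with \<open>n\<close>, such as the indicators of moving
  cells, and families indexed by \<open>u\<close>.\<close>

definition tv_conv :: "(nat \<Rightarrow> 'a::euclidean_space measure) \<Rightarrow> 'a measure \<Rightarrow> bool" where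
  "tv_conv \<mu>s \<mu> \<longleftrightarrow> (\<exists>e. e \<longlonglongrightarrow> 0 \<and> (\<forall>n. \<forall>h\<in>borel_measurable borel. (\<forall>x. \<bar>h x\<bar> \<le> 1) \<longrightarrow>
      \<bar>(\<integral>x. h x \<partial>\<mu>s n) - (\<integral>x. h x \<partial>\<mu>)\<bar> \<le> (e n :: real)))"

lemma tv_conv_const: "tv_conv (\<lambda>_. \<mu>) \<mu>"
  unfolding tv_conv_def by (rule exI[of _ "\<lambda>_. 0"]) simp

lemma tv_conv_subseq: "tv_conv \<mu>s \<mu> \<Longrightarrow> strict_mono r \<Longrightarrow> tv_conv (\<lambda>n. \<mu>s (r n)) \<mu>"
  unfolding tv_conv_def using LIMSEQ_subseq_LIMSEQ[of _ 0 r] unfolding o_def by blast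

text \<open>All masses equal 1, so pointwise convergence of the densities upgrades to convergence in
  the mean. The distance of the densities in the mean is the rate, since it dominates the difference
  of the integrals of any test function bounded by 1.\<close>

lemma tv_conv_densities:
  fixes g :: "'a::euclidean_space \<Rightarrow> real"
  assumes [measurable]: "\<And>n. gs n \<in> borel_measurable borel" "g \<in> borel_measurable borel"
    and nonneg: "\<And>n x. 0 \<le> gs n x" "\<And>x. 0 \<le> g x"
    and prob: "\<And>n. prob_space (density lborel (\<lambda>x. ennreal (gs n x)))" "prob_space (density lborel (\<lambda>x. ennreal (g x)))"
    and lim: "\<And>x. (\<lambda>n. gs n x) \<longlonglongrightarrow> g x"
  shows "tv_conv (\<lambda>n. density lborel (\<lambda>x. ennreal (gs n x))) (density lborel (\<lambda>x. ennreal (g x)))"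
proof -
  have mass: "(\<integral>\<^sup>+x. ennreal (k x) \<partial>lborel) = 1"
    if [measurable]: "k \<in> borel_measurable borel" and "prob_space (density lborel (\<lambda>x. ennreal (k x)))" for k :: "'a \<Rightarrow> real"
    using prob_space.emeasure_space_1[OF that(2)] by (simp add: emeasure_density)
  have int: "integrable lborel k"
    if [measurable]: "k \<in> borel_measurable borel" and "prob_space (density lborel (\<lambda>x. ennreal (k x)))" "\<And>x. 0 \<le> k x"
    for k :: "'a \<Rightarrow> real"
    using mass[OF that(1,2)] that(3) by (intro integrableI_nonneg) auto
  have g_int: "integrable lborel g" and gs_int: "\<And>n. integrable lborel (gs n)"
    using nonneg prob by (auto intro!: int)
  have "(\<lambda>n. \<integral>\<^sup>+x. norm (gs n x - g x) \<partial>lborel) \<longlonglongrightarrow> 0"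
    using lim nonneg mass prob g_int by (intro Scheffe_lemma2) auto
  moreover have "(\<integral>\<^sup>+x. norm (gs n x - g x) \<partial>lborel) = ennreal (\<integral>x. \<bar>gs n x - g x\<bar> \<partial>lborel)" for n
    using g_int gs_int[of n] by (subst nn_integral_eq_integral) auto
  ultimately have "(\<lambda>n. ennreal (\<integral>x. \<bar>gs n x - g x\<bar> \<partial>lborel)) \<longlonglongrightarrow> ennreal 0" by simp
  then have e: "(\<lambda>n. \<integral>x. \<bar>gs n x - g x\<bar> \<partial>lborel) \<longlonglongrightarrow> 0"
    by (subst (asm) tendsto_ennreal_iff) auto
  have "\<bar>(\<integral>x. h x \<partial>density lborel (\<lambda>x. ennreal (gs n x))) - (\<integral>x. h x \<partial>density lborel (\<lambda>x. ennreal (g x)))\<bar>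
      \<le> (\<integral>x. \<bar>gs n x - g x\<bar> \<partial>lborel)"
    if [measurable]: "h \<in> borel_measurable borel" and h1: "\<forall>x. \<bar>h x\<bar> \<le> 1" for n h
  proof -
    have hint: "integrable lborel (\<lambda>x. k x * h x)" if "integrable lborel k" for k :: "'a \<Rightarrow> real"
      using that h1
      by (intro Bochner_Integration.integrable_bound[OF that]) (auto simp: abs_mult intro!: mult_left_le)
    have "(\<integral>x. h x \<partial>density lborel (\<lambda>x. ennreal (gs n x))) - (\<integral>x. h x \<partial>density lborel (\<lambda>x. ennreal (g x)))
        = (\<integral>x. gs n x * h x \<partial>lborel) - (\<integral>x. g x * h x \<partial>lborel)"
      using nonneg by (subst (1 2) integral_density) auto
    also have "\<dots> = (\<integral>x. (gs n x - g x) * h x \<partial>lborel)"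
      using hint[OF g_int] hint[OF gs_int] by (simp add: left_diff_distrib)
    also have "\<bar>\<dots>\<bar> \<le> (\<integral>x. \<bar>gs n x - g x\<bar> \<partial>lborel)"
    proof (rule order_trans[OF integral_abs_bound integral_mono])
      show "integrable lborel (\<lambda>x. \<bar>(gs n x - g x) * h x\<bar>)"
        using g_int gs_int by (intro integrable_abs hint) auto
      show "integrable lborel (\<lambda>x. \<bar>gs n x - g x\<bar>)" using g_int gs_int by auto
      show "\<bar>(gs n x - g x) * h x\<bar> \<le> \<bar>gs n x - g x\<bar>" for x
        using h1 by (auto simp: abs_mult intro!: mult_left_le)
    qed
    finally show ?thesis .
  qed
  then show ?thesis unfolding tv_conv_def using e by blast
qed

text \<open>A density value is not itself the integral of a continuous test function, but its tent
  average is. The common Lipschitz constant makes the error of this replacement small uniformly in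
  \<open>n\<close>.\<close>

lemma weak_conv_imp_tv_conv:
  fixes \<pi> :: "'a::euclidean_space measure"
  assumes \<pi>: "\<pi> \<in> dens_class C C1" and \<pi>s: "\<And>n. \<pi>s n \<in> dens_class C C1"
    and C1: "0 \<le> C1" and weak: "weak_conv_seq \<pi>s \<pi>"
  shows "tv_conv \<pi>s \<pi>"
proof -
  have rep: "\<exists>g. g \<in> borel_measurable borel \<and> \<mu> = density lborel (\<lambda>x. ennreal (g x)) \<and>
          (\<forall>x. 0 \<le> g x \<and> g x \<le> C) \<and> (\<forall>x y. \<bar>g x - g y\<bar> \<le> C1 * dist x y)"
    if "\<mu> \<in> dens_class C C1" for \<mu> :: "'a measure"
    using that unfolding dens_class_def by blast
  obtain g where g [measurable]: "g \<in> borel_measurable borel" and \<pi>_eq: "\<pi> = density lborel (\<lambda>x. ennreal (g x))"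
    and g_bd: "\<And>x. 0 \<le> g x" "\<And>x. g x \<le> C" and g_lip: "\<And>x y. \<bar>g x - g y\<bar> \<le> C1 * dist x y"
    using rep[OF \<pi>] by blast
  obtain gs where gs: "\<And>n. gs n \<in> borel_measurable borel \<and> \<pi>s n = density lborel (\<lambda>x. ennreal (gs n x)) \<and>
          (\<forall>x. 0 \<le> gs n x \<and> gs n x \<le> C) \<and> (\<forall>x y. \<bar>gs n x - gs n y\<bar> \<le> C1 * dist x y)"
    using rep[OF \<pi>s] by metis
  have gs_meas [measurable]: "gs n \<in> borel_measurable borel" for n using gs by blast
  have lim: "(\<lambda>n. gs n x) \<longlonglongrightarrow> g x" for x
  proof (rule LIMSEQ_I)
    fix \<epsilon> :: real assume \<epsilon>: "0 < \<epsilon>"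
    \<comment> \<open>Two averaging errors of at most \<open>\<epsilon> / 4\<close> each leave
      \<open>\<epsilon> / 2\<close> for the weak convergence. The summand 1 covers
      \<open>C1 = 0\<close>.\<close>
    define r where "r = \<epsilon> / (4 * (C1 + 1))"
    have r: "0 < r" using \<epsilon> C1 by (simp add: r_def)
    have "C1 * r \<le> (C1 + 1) * r" using r by simp
    also have "\<dots> = \<epsilon> / 4" using C1 by (simp add: r_def field_simps)
    finally have Cr: "C1 * r \<le> \<epsilon> / 4" .
    define m where "m = (\<integral>y. tent r x y \<partial>lborel)"
    have m: "0 < m" unfolding m_def by (rule integral_tent_pos[OF r])
    have "continuous_on UNIV (tent r x) \<and> bounded (range (tent r x))"
      using continuous_on_tent tent_le_1[OF r]
      by (auto simp: bounded_iff abs_of_nonneg[OF tent_nonneg] intro!: exI[of _ 1])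
    then have "(\<lambda>n. \<integral>y. tent r x y \<partial>\<pi>s n) \<longlonglongrightarrow> (\<integral>y. tent r x y \<partial>\<pi>)"
      using weak unfolding weak_conv_seq_def by blast
    moreover have "(\<integral>y. tent r x y \<partial>density lborel (\<lambda>x. ennreal (k x))) = (\<integral>y. tent r x y * k y \<partial>lborel)"
      if [measurable]: "k \<in> borel_measurable borel" and "\<forall>x. 0 \<le> k x" for k
      using that by (subst integral_density) (auto simp: mult.commute)
    ultimately have "(\<lambda>n. \<integral>y. tent r x y * gs n y \<partial>lborel) \<longlonglongrightarrow> (\<integral>y. tent r x y * g y \<partial>lborel)"
      using gs g_bd by (simp add: \<pi>_eq)
    then have "(\<lambda>n. (\<integral>y. tent r x y * gs n y \<partial>lborel) / m) \<longlonglongrightarrow> (\<integral>y. tent r x y * g y \<partial>lborel) / m"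
      using m by (intro tendsto_intros) auto
    from LIMSEQ_D[OF this, of "\<epsilon> / 2"] obtain N where N: "\<And>n. n \<ge> N \<Longrightarrow>
        \<bar>(\<integral>y. tent r x y * gs n y \<partial>lborel) / m - (\<integral>y. tent r x y * g y \<partial>lborel) / m\<bar> < \<epsilon> / 2"
      using \<epsilon> unfolding real_norm_def by force
    have "norm (gs n x - g x) < \<epsilon>" if "n \<ge> N" for n
    proof -
      have "\<bar>(\<integral>y. tent r x y * g y \<partial>lborel) / m - g x\<bar> \<le> C1 * r"
        unfolding m_def using g_bd g_lip C1 by (intro tent_average_lipschitz[OF r g, where B = C]) auto
      moreover have "\<bar>(\<integral>y. tent r x y * gs n y \<partial>lborel) / m - gs n x\<bar> \<le> C1 * r"
        unfolding m_def using gs[of n] C1 by (intro tent_average_lipschitz[OF r gs_meas, where B = C]) auto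
      ultimately show ?thesis using N[OF that] Cr unfolding real_norm_def by linarith
    qed
    then show "\<exists>N. \<forall>n\<ge>N. norm (gs n x - g x) < \<epsilon>" by blast
  qed
  have prob: "prob_space (density lborel (\<lambda>x. ennreal (gs n x)))" "prob_space (density lborel (\<lambda>x. ennreal (g x)))" for n
    using \<pi> \<pi>s[of n] gs[of n] \<pi>_eq unfolding dens_class_def by auto
  have "tv_conv (\<lambda>n. density lborel (\<lambda>x. ennreal (gs n x))) (density lborel (\<lambda>x. ennreal (g x)))"
    using gs g_bd by (intro tv_conv_densities prob lim) auto
  moreover have "\<pi>s = (\<lambda>n. density lborel (\<lambda>x. ennreal (gs n x)))" using gs by blast
  ultimately show ?thesis using \<pi>_eq by simp
qed

section \<open>Integrals over the cells of a quantizer\<close>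

lemma integrable_prob_bounded:
  fixes h :: "'a::euclidean_space \<Rightarrow> real"
  assumes "\<pi> \<in> space (prob_algebra borel)" "h \<in> borel_measurable borel" "\<And>x. \<bar>h x\<bar> \<le> K"
  shows "integrable \<pi> h"
proof -
  interpret prob_space \<pi> using assms(1) by (simp add: space_prob_algebra)
  have [measurable_cong]: "sets \<pi> = sets borel" using assms(1) by (simp add: space_prob_algebra)
  show ?thesis using assms(2,3) by (intro integrable_const_bound[where B = K]) auto
qed

lemma cell_sets:
  fixes Q :: "'a::euclidean_space \<Rightarrow> nat"
  shows "Q \<in> borel \<rightarrow>\<^sub>M count_space UNIV \<Longrightarrow> Q -` {i} \<in> sets borel"
  using measurable_sets[of Q borel "count_space UNIV" "{i}"] by simp

lemma cell_integrable:
  fixes \<pi> :: "'a::euclidean_space measure" and Q :: "'a \<Rightarrow> nat" and h :: "'a \<Rightarrow> real"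
  assumes "\<pi> \<in> space (prob_algebra borel)" "Q \<in> borel \<rightarrow>\<^sub>M count_space UNIV"
    and "h \<in> borel_measurable borel" "\<And>x. \<bar>h x\<bar> \<le> B"
  shows "integrable \<pi> (\<lambda>x. indicator (Q -` {i :: nat}) x * (h x :: real))"
proof (rule integrable_prob_bounded[OF assms(1), where K = B])
  note [measurable] = assms(3) cell_sets[OF assms(2)]
  show "(\<lambda>x. indicator (Q -` {i}) x * h x) \<in> borel_measurable borel" by measurable
  fix x
  have "0 \<le> B" using assms(4)[of x] by linarith
  then show "\<bar>indicator (Q -` {i}) x * h x\<bar> \<le> B"
    using assms(4)[of x] by (simp add: indicator_def)
qed

text \<open>The upper bound keeps the cell probability as a factor because it cancels the
  normalising constant of the posterior density.\<close>

lemma cell_integral_bounds: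
  fixes \<pi> :: "'a::euclidean_space measure" and Q :: "'a \<Rightarrow> nat" and h :: "'a \<Rightarrow> real"
  assumes \<pi>: "\<pi> \<in> space (prob_algebra borel)" and Q: "Q \<in> borel \<rightarrow>\<^sub>M count_space UNIV"
    and h: "h \<in> borel_measurable borel" "\<And>x. 0 \<le> h x" "\<And>x. h x \<le> B"
  shows "0 \<le> (\<integral>x. indicator (Q -` {i :: nat}) x * h x \<partial>\<pi>)"
    and "(\<integral>x. indicator (Q -` {i}) x * h x \<partial>\<pi>) \<le> B * measure \<pi> (Q -` {i})"
proof -
  interpret prob_space \<pi> using \<pi> by (simp add: space_prob_algebra)
  have [measurable_cong]: "sets \<pi> = sets borel" using \<pi> by (simp add: space_prob_algebra)
  then have [simp]: "space \<pi> = UNIV" using sets_eq_imp_space_eq by force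
  note [measurable] = cell_sets[OF Q]
  show "0 \<le> (\<integral>x. indicator (Q -` {i}) x * h x \<partial>\<pi>)" using h by (intro integral_nonneg_AE) auto
  have "(\<integral>x. indicator (Q -` {i}) x * h x \<partial>\<pi>) \<le> (\<integral>x. indicator (Q -` {i}) x * B \<partial>\<pi>)"
  proof (rule integral_mono)
    show "integrable \<pi> (\<lambda>x. indicator (Q -` {i}) x * h x)"
      using h by (intro cell_integrable[OF \<pi> Q h(1), where B = B]) auto
    show "integrable \<pi> (\<lambda>x. indicator (Q -` {i}) x * B)"
      by (intro cell_integrable[OF \<pi> Q, where B = "\<bar>B\<bar>"]) auto
  qed (use h in \<open>auto simp: indicator_def\<close>)
  also have "\<dots> = B * measure \<pi> (Q -` {i})" by simp
  finally show "(\<integral>x. indicator (Q -` {i}) x * h x \<partial>\<pi>) \<le> B * measure \<pi> (Q -` {i})" .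
qed

text \<open>The explicit factor 1 presents a cell probability as the case \<open>h = 1\<close> of
  the cell integrals.\<close>

lemma cell_measure_eq_integral:
  fixes \<pi> :: "'a::euclidean_space measure"
  assumes \<pi>: "\<pi> \<in> space (prob_algebra borel)"
  shows "(\<integral>x. indicator (Q -` {i :: nat}) x * 1 \<partial>\<pi>) = measure \<pi> (Q -` {i})"
proof -
  have "sets \<pi> = sets borel" using \<pi> by (simp add: space_prob_algebra)
  then have [simp]: "space \<pi> = UNIV" using sets_eq_imp_space_eq by force
  show ?thesis by simp
qed

text \<open>The measure is changed first, with the cell of \<open>Qs n\<close> kept, at cost
  \<open>K * e n\<close>; then the cell is changed under the fixed \<open>\<pi>\<close>, at cost
  \<open>K * d n\<close>. Neither cost depends on \<open>h\<close>.\<close>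

lemma cell_integrals_converge_uniformly:
  fixes \<pi> :: "'a::euclidean_space measure" and Q :: "'a \<Rightarrow> nat"
  assumes \<pi>: "\<pi> \<in> space (prob_algebra borel)" and \<pi>s: "\<And>n. \<pi>s n \<in> space (prob_algebra borel)"
    and tv: "tv_conv \<pi>s \<pi>"
    and Q [measurable]: "Q \<in> borel \<rightarrow>\<^sub>M count_space UNIV" "\<And>n. Qs n \<in> borel \<rightarrow>\<^sub>M count_space UNIV"
    and lim: "\<And>x. \<forall>\<^sub>F n in sequentially. Qs n x = Q x"
    and K: "0 < K"
  shows "\<exists>e. e \<longlonglongrightarrow> 0 \<and> (\<forall>n. \<forall>h\<in>borel_measurable borel. (\<forall>x. \<bar>h x\<bar> \<le> K) \<longrightarrow>
     \<bar>(\<integral>x. indicator (Qs n -` {i}) x * h x \<partial>\<pi>s n) - (\<integral>x. indicator (Q -` {i}) x * h x \<partial>\<pi>)\<bar> \<le> (e n :: real))"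
proof -
  have Q_sets [measurable]: "Q -` {i} \<in> sets borel" "Qs n -` {i} \<in> sets borel" for n
    using Q by (auto intro: cell_sets)
  obtain e where e: "e \<longlonglongrightarrow> 0" "\<And>n h. h \<in> borel_measurable borel \<Longrightarrow> (\<forall>x. \<bar>h x\<bar> \<le> 1) \<Longrightarrow>
      \<bar>(\<integral>x. h x \<partial>\<pi>s n) - (\<integral>x. h x \<partial>\<pi>)\<bar> \<le> (e n :: real)"
    using tv unfolding tv_conv_def by blast
  interpret prob_space \<pi> using \<pi> by (simp add: space_prob_algebra)
  have [measurable_cong]: "sets \<pi> = sets borel" using \<pi> by (simp add: space_prob_algebra)
  \<comment> \<open>This is the probability under \<open>\<pi>\<close> of the symmetric difference
    of the two cells. The indicators agree eventually at every point, so it tends to 0 for an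
    arbitrary \<open>\<pi>\<close>.\<close>
  define d where "d n = (\<integral>x. \<bar>indicator (Qs n -` {i}) x - (indicator (Q -` {i}) x :: real)\<bar> \<partial>\<pi>)" for n
  have "d \<longlonglongrightarrow> (\<integral>x. 0 \<partial>\<pi>)"
    unfolding d_def
  proof (rule integral_dominated_convergence[where w = "\<lambda>_. 1"])
    show "AE x in \<pi>. (\<lambda>n. \<bar>indicator (Qs n -` {i}) x - indicator (Q -` {i}) x\<bar> :: real) \<longlonglongrightarrow> 0"
    proof (rule AE_I2)
      fix x
      show "(\<lambda>n. \<bar>indicator (Qs n -` {i}) x - indicator (Q -` {i}) x\<bar> :: real) \<longlonglongrightarrow> 0"
        by (rule tendsto_eventually, rule eventually_mono[OF lim[of x]]) (simp add: indicator_def)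
    qed
    show "AE x in \<pi>. norm \<bar>indicator (Qs n -` {i}) x - indicator (Q -` {i}) x :: real\<bar> \<le> 1" for n
      by (auto simp: indicator_def)
  qed auto
  then have d: "d \<longlonglongrightarrow> 0" by simp
  have "(\<lambda>n. K * (e n + d n)) \<longlonglongrightarrow> K * (0 + 0)" by (intro tendsto_intros e(1) d)
  moreover have "\<bar>(\<integral>x. indicator (Qs n -` {i}) x * h x \<partial>\<pi>s n) - (\<integral>x. indicator (Q -` {i}) x * h x \<partial>\<pi>)\<bar> \<le> K * (e n + d n)"
    if [measurable]: "h \<in> borel_measurable borel" and hK: "\<forall>x. \<bar>h x\<bar> \<le> K" for n h
  proof -
    have bound: "\<bar>indicator A x * h x\<bar> \<le> K" for A x using hK K by (auto simp: indicator_def)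
    \<comment> \<open>Division by \<open>K\<close> turns the integrand into a test function bounded
      by 1.\<close>
    have "\<bar>(\<integral>x. indicator (Qs n -` {i}) x * h x / K \<partial>\<pi>s n) - (\<integral>x. indicator (Qs n -` {i}) x * h x / K \<partial>\<pi>)\<bar> \<le> e n"
      using bound K by (intro e(2)) auto
    then have "\<bar>((\<integral>x. indicator (Qs n -` {i}) x * h x \<partial>\<pi>s n) - (\<integral>x. indicator (Qs n -` {i}) x * h x \<partial>\<pi>)) / K\<bar> \<le> e n"
      by (simp add: diff_divide_distrib)
    then have 1: "\<bar>(\<integral>x. indicator (Qs n -` {i}) x * h x \<partial>\<pi>s n) - (\<integral>x. indicator (Qs n -` {i}) x * h x \<partial>\<pi>)\<bar> \<le> K * e n"
      using K by (simp add: pos_divide_le_eq mult.commute)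
    have int: "integrable \<pi> (\<lambda>x. indicator (Qs n -` {i}) x * h x)" "integrable \<pi> (\<lambda>x. indicator (Q -` {i}) x * h x)"
      using bound by (auto intro!: integrable_const_bound[where B = K])
    have "(\<integral>x. indicator (Qs n -` {i}) x * h x \<partial>\<pi>) - (\<integral>x. indicator (Q -` {i}) x * h x \<partial>\<pi>)
       = (\<integral>x. indicator (Qs n -` {i}) x * h x - indicator (Q -` {i}) x * h x \<partial>\<pi>)"
      using int by simp
    also have "\<bar>\<dots>\<bar> \<le> (\<integral>x. K * \<bar>indicator (Qs n -` {i}) x - indicator (Q -` {i}) x\<bar> \<partial>\<pi>)"
    proof (rule order_trans[OF integral_abs_bound integral_mono])
      show "integrable \<pi> (\<lambda>x. \<bar>indicator (Qs n -` {i}) x * h x - indicator (Q -` {i}) x * h x\<bar>)"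
        using int by auto
      show "integrable \<pi> (\<lambda>x. K * \<bar>indicator (Qs n -` {i}) x - indicator (Q -` {i}) x\<bar>)"
        by (intro integrable_mult_right integrable_const_bound[where B = 1]) (auto simp: indicator_def)
      show "\<bar>indicator (Qs n -` {i}) x * h x - indicator (Q -` {i}) x * h x\<bar>
          \<le> K * \<bar>indicator (Qs n -` {i}) x - indicator (Q -` {i}) x\<bar>" for x
        using hK by (auto simp: indicator_def)
    qed
    also have "\<dots> = K * d n" by (simp add: d_def)
    finally show ?thesis using 1 by (simp add: distrib_left)
  qed
  ultimately show ?thesis by (intro exI[of _ "\<lambda>n. K * (e n + d n)"]) simp
qed

section \<open>Dynamic programming\<close>

text \<open>An infimum moves by no more than the uniform distance of the functions, which carries
  convergence uniform in \<open>u\<close> over to the stage cost.\<close>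

lemma INF_uniform_diff:
  fixes f g :: "'b \<Rightarrow> real"
  assumes "A \<noteq> {}" "bdd_below (f ` A)" "bdd_below (g ` A)" "\<And>u. u \<in> A \<Longrightarrow> \<bar>f u - g u\<bar> \<le> e"
  shows "\<bar>(INF u\<in>A. f u) - (INF u\<in>A. g u)\<bar> \<le> e"
proof -
  have *: "(INF u\<in>A. p u) - e \<le> (INF u\<in>A. q u)"
    if "bdd_below (p ` A)" "\<And>u. u \<in> A \<Longrightarrow> \<bar>p u - q u\<bar> \<le> e" for p q :: "'b \<Rightarrow> real"
  proof (rule cINF_greatest[OF assms(1)])
    fix u assume u: "u \<in> A"
    then show "(INF u\<in>A. p u) - e \<le> q u"
      using cINF_lower[OF that(1) u] that(2)[OF u] by linarith
  qed
  have "(INF u\<in>A. f u) - e \<le> (INF u\<in>A. g u)" using assms by (intro *) auto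
  moreover have "(INF u\<in>A. g u) - e \<le> (INF u\<in>A. f u)"
    using assms(3,4) by (intro *) (auto simp: abs_minus_commute)
  ultimately show ?thesis by linarith
qed

lemma dens_class_prob: "dens_class C C1 \<subseteq> space (prob_algebra borel)"
  by (auto simp: dens_class_def space_prob_algebra)

section \<open>The posterior as an average of transition densities\<close>

text \<open>The real-valued density inside \<open>filter_update\<close>, isolated because membership
  in \<open>dens_class\<close> and convergence are both read off from it pointwise.\<close>

definition filter_density :: "('a::euclidean_space \<Rightarrow> 'a \<Rightarrow> real) \<Rightarrow> nat \<Rightarrow> 'a measure \<Rightarrow> ('a \<Rightarrow> nat) \<Rightarrow> 'a \<Rightarrow> real" where
  "filter_density \<phi> m \<pi> Q z = (\<integral>x. indicator (Q -` {m}) x * \<phi> x z \<partial>\<pi>) / measure \<pi> (Q -` {m})"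

text \<open>The source is represented by its transition density alone, with
  \<open>\<phi> x z\<close> the density at \<open>z\<close> of the state following \<open>x\<close>.
  Joint measurability is what the exchange of integrals in the normalisation of the posterior rests
  on.\<close>

locale quantized_control =
  fixes \<phi> :: "'a::euclidean_space \<Rightarrow> 'a \<Rightarrow> real" and C C1 :: real
    and c0 :: "'a \<Rightarrow> 'u \<Rightarrow> real" and U :: "'u set" and K :: real and M T :: nat
  assumes \<phi>_measurable [measurable]: "(\<lambda>(x, z). \<phi> x z) \<in> borel_measurable (borel \<Otimes>\<^sub>M borel)"
    and \<phi>_mass: "\<And>x. (\<integral>\<^sup>+z. ennreal (\<phi> x z) \<partial>lborel) = 1"
    and \<phi>_nonneg: "\<And>x z. 0 \<le> \<phi> x z"
    and \<phi>_le: "\<And>x z. \<phi> x z \<le> C"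
    and \<phi>_lipschitz: "\<And>x z z'. \<bar>\<phi> x z - \<phi> x z'\<bar> \<le> C1 * dist z z'"
    and C1_nonneg: "0 \<le> C1" and C_pos: "0 < C"
    and c0_measurable: "\<And>u. u \<in> U \<Longrightarrow> (\<lambda>x. c0 x u) \<in> borel_measurable borel"
    and c0_nonneg: "\<And>x u. u \<in> U \<Longrightarrow> 0 \<le> c0 x u"
    and c0_le: "\<And>x u. u \<in> U \<Longrightarrow> c0 x u \<le> K"
    and K_pos: "0 < K"
    and U_nonempty: "U \<noteq> {}"
    and M_pos: "1 \<le> M"
begin

lemma \<phi>_section_measurable: "(\<lambda>x. \<phi> x z) \<in> borel_measurable borel"
  by measurable

lemma filter_density_bounds:
  assumes "\<pi> \<in> space (prob_algebra borel)" "Q \<in> borel \<rightarrow>\<^sub>M count_space UNIV" "measure \<pi> (Q -` {m}) \<noteq> 0"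
  shows "0 \<le> filter_density \<phi> m \<pi> Q z" "filter_density \<phi> m \<pi> Q z \<le> C"
proof -
  have "0 < measure \<pi> (Q -` {m})" using assms(3) by (simp add: zero_less_measure_iff)
  then show "0 \<le> filter_density \<phi> m \<pi> Q z" "filter_density \<phi> m \<pi> Q z \<le> C"
    using cell_integral_bounds[OF assms(1,2) \<phi>_section_measurable \<phi>_nonneg \<phi>_le, of m z]
    by (auto simp: filter_density_def pos_divide_le_eq)
qed

text \<open>The estimate \<open>C1 * dist z z'\<close> holds under the integral for each
  \<open>x\<close>; integration over the cell multiplies it by the cell probability, which the
  normalisation divides out.\<close>

lemma filter_density_lipschitz:
  assumes "\<pi> \<in> space (prob_algebra borel)" "Q \<in> borel \<rightarrow>\<^sub>M count_space UNIV" "measure \<pi> (Q -` {m}) \<noteq> 0"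
  shows "\<bar>filter_density \<phi> m \<pi> Q z - filter_density \<phi> m \<pi> Q z'\<bar> \<le> C1 * dist z z'"
proof -
  have pos: "0 < measure \<pi> (Q -` {m})" using assms(3) by (simp add: zero_less_measure_iff)
  have int: "integrable \<pi> (\<lambda>x. indicator (Q -` {m}) x * \<phi> x z)" for z
    using \<phi>_nonneg \<phi>_le by (intro cell_integrable[OF assms(1,2) \<phi>_section_measurable, where B = C]) auto
  have "(\<integral>x. indicator (Q -` {m}) x * \<phi> x z \<partial>\<pi>) - (\<integral>x. indicator (Q -` {m}) x * \<phi> x z' \<partial>\<pi>)
      = (\<integral>x. indicator (Q -` {m}) x * \<phi> x z - indicator (Q -` {m}) x * \<phi> x z' \<partial>\<pi>)"
    using int by simp
  also have "\<bar>\<dots>\<bar> \<le> (\<integral>x. \<bar>indicator (Q -` {m}) x * \<phi> x z - indicator (Q -` {m}) x * \<phi> x z'\<bar> \<partial>\<pi>)"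
    by (rule integral_abs_bound)
  also have "\<dots> = (\<integral>x. indicator (Q -` {m}) x * \<bar>\<phi> x z - \<phi> x z'\<bar> \<partial>\<pi>)"
    by (intro Bochner_Integration.integral_cong) (auto simp: indicator_def)
  also have "\<dots> \<le> C1 * dist z z' * measure \<pi> (Q -` {m})"
    using \<phi>_lipschitz by (intro cell_integral_bounds(2)[OF assms(1,2)]) auto
  finally show ?thesis
    using pos by (simp add: filter_density_def pos_divide_le_eq flip: diff_divide_distrib)
qed

lemma filter_density_measurable:
  assumes "\<pi> \<in> space (prob_algebra borel)" "Q \<in> borel \<rightarrow>\<^sub>M count_space UNIV" "measure \<pi> (Q -` {m}) \<noteq> 0"
  shows "filter_density \<phi> m \<pi> Q \<in> borel_measurable borel"
proof (rule borel_measurable_continuous_onI)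
  have "C1-lipschitz_on UNIV (filter_density \<phi> m \<pi> Q)"
    using filter_density_lipschitz[OF assms] C1_nonneg by (intro lipschitz_onI) (auto simp: dist_real_def)
  then show "continuous_on UNIV (filter_density \<phi> m \<pi> Q)" by (rule lipschitz_on_continuous_on)
qed

text \<open>Exchanging the integrals, each \<open>\<phi> x\<close> contributes mass 1, so the
  unnormalised density has the cell probability as its mass. The prior is any Borel probability
  measure: even from a point mass, one step leads into the class.\<close>

lemma filter_update_in_dens_class:
  assumes \<pi>: "\<pi> \<in> space (prob_algebra borel)" and Q: "Q \<in> borel \<rightarrow>\<^sub>M count_space UNIV"
    and nz: "measure \<pi> (Q -` {m}) \<noteq> 0"
  shows "filter_update \<phi> m \<pi> Q \<in> dens_class C C1"
proof -
  interpret prob_space \<pi> using \<pi> by (simp add: space_prob_algebra)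
  interpret pair_sigma_finite lborel \<pi> ..
  have sets_\<pi> [measurable_cong]: "sets \<pi> = sets borel" using \<pi> by (simp add: space_prob_algebra)
  then have [simp]: "space \<pi> = UNIV" using sets_eq_imp_space_eq by force
  note [measurable] = cell_sets[OF Q] filter_density_measurable[OF assms]
  have pos: "0 < measure \<pi> (Q -` {m})" using nz by (simp add: zero_less_measure_iff)
  have eq: "filter_update \<phi> m \<pi> Q = density lborel (\<lambda>z. ennreal (filter_density \<phi> m \<pi> Q z))"
    by (simp add: filter_update_def filter_density_def)
  have "(\<integral>\<^sup>+z. ennreal (filter_density \<phi> m \<pi> Q z) \<partial>lborel)
      = (\<integral>\<^sup>+z. (\<integral>\<^sup>+x. ennreal (indicator (Q -` {m}) x * \<phi> x z) \<partial>\<pi>) / ennreal (measure \<pi> (Q -` {m})) \<partial>lborel)"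
  proof (rule nn_integral_cong)
    fix z
    have "integrable \<pi> (\<lambda>x. indicator (Q -` {m}) x * \<phi> x z)"
      using \<phi>_nonneg \<phi>_le by (intro cell_integrable[OF \<pi> Q \<phi>_section_measurable, where B = C]) auto
    then have "(\<integral>\<^sup>+x. ennreal (indicator (Q -` {m}) x * \<phi> x z) \<partial>\<pi>) = ennreal (\<integral>x. indicator (Q -` {m}) x * \<phi> x z \<partial>\<pi>)"
      using \<phi>_nonneg by (intro nn_integral_eq_integral) auto
    then show "ennreal (filter_density \<phi> m \<pi> Q z)
        = (\<integral>\<^sup>+x. ennreal (indicator (Q -` {m}) x * \<phi> x z) \<partial>\<pi>) / ennreal (measure \<pi> (Q -` {m}))"
      using pos \<phi>_nonneg by (simp add: filter_density_def divide_ennreal integral_nonneg_AE)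
  qed
  also have "\<dots> = (\<integral>\<^sup>+z. (\<integral>\<^sup>+x. ennreal (indicator (Q -` {m}) x * \<phi> x z) \<partial>\<pi>) \<partial>lborel) / ennreal (measure \<pi> (Q -` {m}))"
    by (rule nn_integral_divide) measurable
  also have "(\<integral>\<^sup>+z. (\<integral>\<^sup>+x. ennreal (indicator (Q -` {m}) x * \<phi> x z) \<partial>\<pi>) \<partial>lborel)
      = (\<integral>\<^sup>+x. (\<integral>\<^sup>+z. ennreal (indicator (Q -` {m}) x * \<phi> x z) \<partial>lborel) \<partial>\<pi>)"
    by (rule Fubini'[symmetric]) measurable
  also have "\<dots> = (\<integral>\<^sup>+x. indicator (Q -` {m}) x \<partial>\<pi>)"
    by (intro nn_integral_cong) (auto simp: indicator_def \<phi>_mass)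
  also have "\<dots> = ennreal (measure \<pi> (Q -` {m}))"
    by (subst nn_integral_indicator) (auto simp: emeasure_eq_measure)
  also have "\<dots> / ennreal (measure \<pi> (Q -` {m})) = 1"
    using pos by (simp add: divide_ennreal)
  finally have "prob_space (filter_update \<phi> m \<pi> Q)"
    by (intro prob_spaceI) (simp add: eq emeasure_density)
  then show ?thesis
    unfolding dens_class_def eq
    using filter_density_bounds[OF assms] filter_density_lipschitz[OF assms] filter_density_measurable[OF assms]
    by blast
qed

section \<open>Joint continuity in the measure and the quantizer\<close>

context
  fixes \<pi>s :: "nat \<Rightarrow> 'a measure" and \<pi> :: "'a measure" and Qs :: "nat \<Rightarrow> 'a \<Rightarrow> nat" and Q :: "'a \<Rightarrow> nat"
  assumes \<pi>: "\<pi> \<in> space (prob_algebra borel)" and \<pi>s: "\<And>n. \<pi>s n \<in> space (prob_algebra borel)"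
    and tv: "tv_conv \<pi>s \<pi>"
    and Q: "Q \<in> borel \<rightarrow>\<^sub>M count_space UNIV" and Qs: "\<And>n. Qs n \<in> borel \<rightarrow>\<^sub>M count_space UNIV"
    and lim: "\<And>x. \<forall>\<^sub>F n in sequentially. Qs n x = Q x"
begin

lemma cell_integral_tendsto:
  assumes "h \<in> borel_measurable borel" "\<And>x. \<bar>h x\<bar> \<le> B" "0 < B"
  shows "(\<lambda>n. \<integral>x. indicator (Qs n -` {i}) x * (h x :: real) \<partial>\<pi>s n) \<longlonglongrightarrow> (\<integral>x. indicator (Q -` {i}) x * h x \<partial>\<pi>)"
proof -
  obtain e where e: "e \<longlonglongrightarrow> 0" and "\<forall>n. \<forall>h\<in>borel_measurable borel. (\<forall>x. \<bar>h x\<bar> \<le> B) \<longrightarrow>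
      \<bar>(\<integral>x. indicator (Qs n -` {i}) x * h x \<partial>\<pi>s n) - (\<integral>x. indicator (Q -` {i}) x * h x \<partial>\<pi>)\<bar> \<le> (e n :: real)"
    using cell_integrals_converge_uniformly[OF \<pi> \<pi>s tv Q Qs lim \<open>0 < B\<close>, of i] by blast
  then have "\<bar>(\<integral>x. indicator (Qs n -` {i}) x * h x \<partial>\<pi>s n) - (\<integral>x. indicator (Q -` {i}) x * h x \<partial>\<pi>)\<bar> \<le> e n" for n
    using assms by blast
  then show ?thesis
    by (intro LIM_zero_cancel[OF Lim_null_comparison[OF _ e]]) simp
qed

lemma cell_measure_tendsto:
  "(\<lambda>n. measure (\<pi>s n) (Qs n -` {i})) \<longlonglongrightarrow> measure \<pi> (Q -` {i})"
  using cell_integral_tendsto[of "\<lambda>_. 1" 1 i]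
  by (simp only: cell_measure_eq_integral[OF \<pi>] cell_measure_eq_integral[OF \<pi>s]) simp

text \<open>One rate \<open>e\<close> serves all the integrands for \<open>u\<close> in
  \<open>U\<close> at once, since they share the bound \<open>K\<close>; hence it survives the
  infimum.\<close>

lemma qcost_tendsto: "(\<lambda>n. qcost M c0 U (\<pi>s n) (Qs n)) \<longlonglongrightarrow> qcost M c0 U \<pi> Q"
  unfolding qcost_def
proof (rule tendsto_sum)
  fix i :: nat
  let ?F = "\<lambda>\<mu> q u. \<integral>x. indicator (q -` {i}) x * c0 x u \<partial>\<mu>"
  obtain e where e: "e \<longlonglongrightarrow> 0" and "\<forall>n. \<forall>h\<in>borel_measurable borel. (\<forall>x. \<bar>h x\<bar> \<le> K) \<longrightarrow>
      \<bar>(\<integral>x. indicator (Qs n -` {i}) x * h x \<partial>\<pi>s n) - (\<integral>x. indicator (Q -` {i}) x * h x \<partial>\<pi>)\<bar> \<le> (e n :: real)"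
    using cell_integrals_converge_uniformly[OF \<pi> \<pi>s tv Q Qs lim K_pos, of i] by blast
  then have diff: "\<bar>?F (\<pi>s n) (Qs n) u - ?F \<pi> Q u\<bar> \<le> e n" if "u \<in> U" for n u
    using c0_measurable[OF that] c0_nonneg[OF that] c0_le[OF that] by simp
  have bdd: "bdd_below (?F \<mu> q ` U)"
    if "\<mu> \<in> space (prob_algebra borel)" "q \<in> borel \<rightarrow>\<^sub>M count_space UNIV" for \<mu> q
    using cell_integral_bounds(1)[OF that c0_measurable c0_nonneg c0_le]
    by (intro bdd_belowI[of _ 0]) blast
  have "\<bar>(INF u\<in>U. ?F (\<pi>s n) (Qs n) u) - (INF u\<in>U. ?F \<pi> Q u)\<bar> \<le> e n" for n
    by (intro INF_uniform_diff U_nonempty bdd \<pi> \<pi>s Q Qs diff)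
  then show "(\<lambda>n. INF u\<in>U. ?F (\<pi>s n) (Qs n) u) \<longlonglongrightarrow> (INF u\<in>U. ?F \<pi> Q u)"
    by (intro LIM_zero_cancel[OF Lim_null_comparison[OF _ e]]) simp
qed

text \<open>For each \<open>z\<close>, numerator and denominator of the density are cell integrals
  and converge; \<open>tv_conv_densities\<close> turns this pointwise convergence into convergence
  of the posteriors.\<close>

lemma filter_update_tv_conv:
  assumes nz: "measure \<pi> (Q -` {m}) \<noteq> 0" "\<And>n. measure (\<pi>s n) (Qs n -` {m}) \<noteq> 0"
  shows "tv_conv (\<lambda>n. filter_update \<phi> m (\<pi>s n) (Qs n)) (filter_update \<phi> m \<pi> Q)"
proof -
  have eq: "filter_update \<phi> m \<mu> q = density lborel (\<lambda>z. ennreal (filter_density \<phi> m \<mu> q z))" for \<mu> q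
    by (simp add: filter_update_def filter_density_def)
  have "prob_space (filter_update \<phi> m (\<pi>s n) (Qs n))" "prob_space (filter_update \<phi> m \<pi> Q)" for n
    using filter_update_in_dens_class[OF \<pi>s Qs nz(2)] filter_update_in_dens_class[OF \<pi> Q nz(1)]
    by (auto simp: dens_class_def)
  moreover have "(\<lambda>n. filter_density \<phi> m (\<pi>s n) (Qs n) z) \<longlonglongrightarrow> filter_density \<phi> m \<pi> Q z" for z
    unfolding filter_density_def using \<phi>_nonneg \<phi>_le C_pos nz(1)
    by (intro tendsto_divide cell_measure_tendsto cell_integral_tendsto[where B = C] \<phi>_section_measurable) auto
  ultimately show ?thesis
    unfolding eq
    using filter_density_bounds(1)[OF \<pi>s Qs nz(2)] filter_density_bounds(1)[OF \<pi> Q nz(1)]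
      filter_density_measurable[OF \<pi>s Qs nz(2)] filter_density_measurable[OF \<pi> Q nz(1)]
    by (intro tv_conv_densities)
qed

end

section \<open>Value functions and optimal quantizers\<close>

text \<open>The invariant of the backward induction. It is confined to
  \<open>dens_class C C1\<close>, where all posteriors lie; the uniform bound controls the cells of
  vanishing probability.\<close>

definition regular_value :: "('a measure \<Rightarrow> real) \<Rightarrow> bool" where
  "regular_value J \<longleftrightarrow> (\<exists>B. \<forall>\<mu>\<in>dens_class C C1. 0 \<le> J \<mu> \<and> J \<mu> \<le> B) \<and>
     (\<forall>\<mu>s. \<forall>\<mu>\<in>dens_class C C1. (\<forall>n. \<mu>s n \<in> dens_class C C1) \<longrightarrow> tv_conv \<mu>s \<mu> \<longrightarrow> (\<lambda>n. J (\<mu>s n)) \<longlonglongrightarrow> J \<mu>)"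

lemma stage_obj_tendsto:
  assumes J: "regular_value J"
    and \<pi>: "\<pi> \<in> space (prob_algebra borel)" and \<pi>s: "\<And>n. \<pi>s n \<in> space (prob_algebra borel)"
    and tv: "tv_conv \<pi>s \<pi>"
    and Q: "Q \<in> borel \<rightarrow>\<^sub>M count_space UNIV" and Qs: "\<And>n. Qs n \<in> borel \<rightarrow>\<^sub>M count_space UNIV"
    and lim: "\<And>x. \<forall>\<^sub>F n in sequentially. Qs n x = Q x"
  shows "(\<lambda>n. stage_obj M c0 U \<phi> T J (\<pi>s n) (Qs n)) \<longlonglongrightarrow> stage_obj M c0 U \<phi> T J \<pi> Q"
  unfolding stage_obj_def
proof (intro tendsto_add tendsto_mult tendsto_const tendsto_sum qcost_tendsto[OF \<pi> \<pi>s tv Q Qs lim])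
  fix m :: nat
  let ?p = "\<lambda>\<mu> q. measure \<mu> (q -` {m})"
  let ?g = "\<lambda>\<mu> q. if ?p \<mu> q = 0 then 0 else J (filter_update \<phi> m \<mu> q) * ?p \<mu> q"
  obtain B where B: "\<And>\<mu>. \<mu> \<in> dens_class C C1 \<Longrightarrow> 0 \<le> J \<mu>" "\<And>\<mu>. \<mu> \<in> dens_class C C1 \<Longrightarrow> J \<mu> \<le> B"
    using J unfolding regular_value_def by blast
  have J_cont: "(\<lambda>n. J (\<mu>s n)) \<longlonglongrightarrow> J \<mu>"
    if "\<mu> \<in> dens_class C C1" "\<And>n. \<mu>s n \<in> dens_class C C1" "tv_conv \<mu>s \<mu>" for \<mu>s \<mu>
    using J that unfolding regular_value_def by blast
  note p_lim = cell_measure_tendsto[OF \<pi> \<pi>s tv Q Qs lim, of m]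
  show "(\<lambda>n. ?g (\<pi>s n) (Qs n)) \<longlonglongrightarrow> ?g \<pi> Q"
  proof (cases "?p \<pi> Q = 0")
    case True
    \<comment> \<open>The posteriors need not converge here, but bounded values times vanishing
      probabilities tend to 0. The absolute value spares a sign condition on
      \<open>B\<close>.\<close>
    have "norm (?g (\<pi>s n) (Qs n)) \<le> \<bar>B\<bar> * ?p (\<pi>s n) (Qs n)" for n
    proof (cases "?p (\<pi>s n) (Qs n) = 0")
      case False
      note S = filter_update_in_dens_class[OF \<pi>s Qs False]
      show ?thesis using False B(1)[OF S] B(2)[OF S] by (simp add: abs_mult mult_right_mono)
    qed simp
    then have "\<forall>\<^sub>F n in sequentially. norm (?g (\<pi>s n) (Qs n)) \<le> \<bar>B\<bar> * ?p (\<pi>s n) (Qs n)"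
      by (intro always_eventually allI)
    moreover have "(\<lambda>n. \<bar>B\<bar> * ?p (\<pi>s n) (Qs n)) \<longlonglongrightarrow> 0"
      using tendsto_mult_left[OF p_lim, of "\<bar>B\<bar>"] True by simp
    ultimately have "(\<lambda>n. ?g (\<pi>s n) (Qs n)) \<longlonglongrightarrow> 0"
      by (rule Lim_null_comparison)
    then show ?thesis using True by simp
  next
    case False
    then have "\<forall>\<^sub>F n in sequentially. ?p (\<pi>s n) (Qs n) \<noteq> 0"
      using tendsto_imp_eventually_ne[OF p_lim] by blast
    \<comment> \<open>Positive cell probability is guaranteed only from some index on, whereas
      \<open>filter_update_tv_conv\<close> asks for it at every index; hence the shift by
      \<open>N\<close>.\<close>
    then obtain N where "\<And>n. n \<ge> N \<Longrightarrow> ?p (\<pi>s n) (Qs n) \<noteq> 0"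
      unfolding eventually_sequentially by blast
    then have N: "?p (\<pi>s (n + N)) (Qs (n + N)) \<noteq> 0" for n by simp
    have "strict_mono (\<lambda>n. n + N)" by (simp add: strict_mono_def)
    note tvN = tv_conv_subseq[OF tv this]
    have limN: "\<forall>\<^sub>F n in sequentially. Qs (n + N) x = Q x" for x
      using lim[of x] by (subst eventually_sequentially_seg[of "\<lambda>n. Qs n x = Q x"])
    have "tv_conv (\<lambda>n. filter_update \<phi> m (\<pi>s (n + N)) (Qs (n + N))) (filter_update \<phi> m \<pi> Q)"
      by (intro filter_update_tv_conv[OF \<pi> \<pi>s tvN Q Qs limN] False N)
    then have "(\<lambda>n. J (filter_update \<phi> m (\<pi>s (n + N)) (Qs (n + N)))) \<longlonglongrightarrow> J (filter_update \<phi> m \<pi> Q)"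
      by (intro J_cont filter_update_in_dens_class[OF \<pi> Q False] filter_update_in_dens_class[OF \<pi>s Qs N])
    then have "(\<lambda>n. ?g (\<pi>s (n + N)) (Qs (n + N))) \<longlonglongrightarrow> ?g \<pi> Q"
      using N False LIMSEQ_ignore_initial_segment[OF p_lim, of N] by (simp add: tendsto_mult)
    then show ?thesis by (rule LIMSEQ_offset)
  qed
qed

lemma qcost_bounds:
  assumes \<pi>: "\<pi> \<in> space (prob_algebra borel)" and Q: "Q \<in> borel \<rightarrow>\<^sub>M count_space UNIV"
  shows "0 \<le> qcost M c0 U \<pi> Q" "qcost M c0 U \<pi> Q \<le> real M * K"
proof -
  interpret prob_space \<pi> using \<pi> by (simp add: space_prob_algebra)
  let ?F = "\<lambda>i u. \<integral>x. indicator (Q -` {i}) x * c0 x u \<partial>\<pi>"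
  have nonneg: "0 \<le> ?F i u" if "u \<in> U" for i u
    using cell_integral_bounds(1)[OF \<pi> Q c0_measurable[OF that] c0_nonneg[OF that] c0_le[OF that]] .
  have le: "?F i u \<le> K" if "u \<in> U" for i u
  proof -
    have "?F i u \<le> K * measure \<pi> (Q -` {i})"
      using cell_integral_bounds(2)[OF \<pi> Q c0_measurable[OF that] c0_nonneg[OF that] c0_le[OF that]] .
    also have "\<dots> \<le> K" using K_pos by (intro mult_left_le) auto
    finally show ?thesis .
  qed
  show "0 \<le> qcost M c0 U \<pi> Q"
    unfolding qcost_def using U_nonempty nonneg by (intro sum_nonneg cINF_greatest) auto
  have "(INF u\<in>U. ?F i u) \<le> K" for i
  proof -
    obtain u where u: "u \<in> U" using U_nonempty by blast
    have "(INF u\<in>U. ?F i u) \<le> ?F i u" using nonneg u by (intro cINF_lower bdd_belowI[of _ 0]) auto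
    then show ?thesis using le[OF u, of i] by linarith
  qed
  then have "qcost M c0 U \<pi> Q \<le> (\<Sum>i=1..M. K)"
    unfolding qcost_def by (intro sum_mono)
  then show "qcost M c0 U \<pi> Q \<le> real M * K" by simp
qed

lemma stage_obj_bounds:
  assumes \<pi>: "\<pi> \<in> space (prob_algebra borel)" and Q: "Q \<in> borel \<rightarrow>\<^sub>M count_space UNIV"
    and J: "\<And>\<mu>. \<mu> \<in> dens_class C C1 \<Longrightarrow> 0 \<le> J \<mu>" "\<And>\<mu>. \<mu> \<in> dens_class C C1 \<Longrightarrow> J \<mu> \<le> B"
  shows "0 \<le> stage_obj M c0 U \<phi> T J \<pi> Q"
    and "stage_obj M c0 U \<phi> T J \<pi> Q \<le> (1 / real T) * (real M * K) + real M * \<bar>B\<bar>"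
proof -
  interpret prob_space \<pi> using \<pi> by (simp add: space_prob_algebra)
  let ?g = "\<lambda>m. if measure \<pi> (Q -` {m}) = 0 then 0 else J (filter_update \<phi> m \<pi> Q) * measure \<pi> (Q -` {m})"
  have g: "0 \<le> ?g m \<and> ?g m \<le> \<bar>B\<bar>" for m
  proof (cases "measure \<pi> (Q -` {m}) = 0")
    case False
    note S = filter_update_in_dens_class[OF \<pi> Q False]
    have "J (filter_update \<phi> m \<pi> Q) * measure \<pi> (Q -` {m}) \<le> \<bar>B\<bar> * 1"
      using J(1)[OF S] J(2)[OF S] by (intro mult_mono) auto
    then show ?thesis using False J(1)[OF S] by simp
  qed simp
  have "0 \<le> (\<Sum>m=1..M. ?g m)" by (rule sum_nonneg) (use g in blast)
  then show "0 \<le> stage_obj M c0 U \<phi> T J \<pi> Q"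
    unfolding stage_obj_def using qcost_bounds(1)[OF \<pi> Q] by simp
  have "(\<Sum>m=1..M. ?g m) \<le> (\<Sum>m=1..M. \<bar>B\<bar>)" by (rule sum_mono) (use g in blast)
  then show "stage_obj M c0 U \<phi> T J \<pi> Q \<le> (1 / real T) * (real M * K) + real M * \<bar>B\<bar>"
    unfolding stage_obj_def using qcost_bounds(2)[OF \<pi> Q]
    by (intro add_mono mult_left_mono) simp_all
qed

lemma quantizers_c_nonempty: "(quantizers_c M :: ('a \<Rightarrow> nat) set) \<noteq> {}"
proof -
  have "convex ((\<lambda>_. 1 :: nat) -` {i} :: 'a set)" for i by (cases "i = 1") auto
  then have "(\<lambda>_. 1) \<in> (quantizers_c M :: ('a \<Rightarrow> nat) set)"
    unfolding quantizers_c_def using M_pos by simp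
  then show ?thesis by blast
qed

lemma stage_obj_INF_le:
  assumes "regular_value J" "\<pi> \<in> space (prob_algebra borel)" "Q \<in> quantizers_c M"
  shows "(INF Q\<in>quantizers_c M. stage_obj M c0 U \<phi> T J \<pi> Q) \<le> stage_obj M c0 U \<phi> T J \<pi> Q"
proof (rule cINF_lower[OF _ assms(3)])
  obtain B where "\<And>\<mu>. \<mu> \<in> dens_class C C1 \<Longrightarrow> 0 \<le> J \<mu>" "\<And>\<mu>. \<mu> \<in> dens_class C C1 \<Longrightarrow> J \<mu> \<le> B"
    using assms(1) unfolding regular_value_def by blast
  then show "bdd_below (stage_obj M c0 U \<phi> T J \<pi> ` quantizers_c M)"
    using stage_obj_bounds(1)[OF assms(2) quantizers_c_measurable] by (intro bdd_belowI[of _ 0]) blast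
qed

lemma stage_obj_INF_attained:
  assumes J: "regular_value J" and \<pi>: "\<pi> \<in> space (prob_algebra borel)"
  shows "\<exists>Q\<in>quantizers_c M. (INF Q\<in>quantizers_c M. stage_obj M c0 U \<phi> T J \<pi> Q) = stage_obj M c0 U \<phi> T J \<pi> Q"
proof -
  let ?f = "stage_obj M c0 U \<phi> T J \<pi>"
  define I where "I = (INF Q\<in>quantizers_c M. ?f Q)"
  have "\<exists>Q\<in>quantizers_c M. ?f Q < I + 1 / real (Suc n)" for n
  proof -
    have "Inf (?f ` quantizers_c M) < I + 1 / real (Suc n)" by (simp add: I_def)
    from cInf_lessD[OF _ this] show ?thesis using quantizers_c_nonempty by blast
  qed
  then obtain Qs where Qs: "\<And>n. Qs n \<in> quantizers_c M" "\<And>n. ?f (Qs n) < I + 1 / real (Suc n)" by metis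
  obtain r Q where r: "strict_mono r" and Q: "Q \<in> quantizers_c M"
    and lim: "\<And>x. \<forall>\<^sub>F n in sequentially. Qs (r n) x = Q x"
    using quantizers_c_subsequence[of Qs, OF Qs(1)] by blast
  have "(\<lambda>n. ?f (Qs (r n))) \<longlonglongrightarrow> ?f Q"
    \<comment> \<open>Only the quantizer varies: the measures form a constant sequence.\<close>
    by (intro stage_obj_tendsto[OF J \<pi> \<pi> tv_conv_const quantizers_c_measurable[OF Q] quantizers_c_measurable[OF Qs(1)] lim])
  moreover have "(\<lambda>n. ?f (Qs (r n))) \<longlonglongrightarrow> I"
  proof (rule tendsto_sandwich[of "\<lambda>_. I" _ _ "\<lambda>n. I + 1 / real (Suc (r n))"])
    have "(\<lambda>n. 1 / real (Suc (r n))) \<longlonglongrightarrow> 0"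
      using LIMSEQ_subseq_LIMSEQ[OF LIMSEQ_inverse_real_of_nat r] by (simp add: o_def inverse_eq_divide)
    then show "(\<lambda>n. I + 1 / real (Suc (r n))) \<longlonglongrightarrow> I"
      using tendsto_add[OF tendsto_const[of I]] by force
    show "\<forall>\<^sub>F n in sequentially. I \<le> ?f (Qs (r n))"
      using stage_obj_INF_le[OF J \<pi> Qs(1)] by (simp add: I_def)
    show "\<forall>\<^sub>F n in sequentially. ?f (Qs (r n)) \<le> I + 1 / real (Suc (r n))"
      using Qs(2) by (simp add: less_imp_le)
  qed simp
  ultimately have "I = ?f Q" using LIMSEQ_unique by blast
  then show ?thesis using Q unfolding I_def by blast
qed

text \<open>If values stayed away from the limit along a subsequence, optimal quantizers along it
  would converge, after a further extraction, to some \<open>Q\<close>. Comparison with a quantizer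
  optimal for the limit measure shows that \<open>Q\<close> is optimal there too, so the values
  converge along the extraction after all.\<close>

lemma regular_value_stage:
  assumes J: "regular_value J"
  shows "regular_value (\<lambda>\<pi>. INF Q\<in>quantizers_c M. stage_obj M c0 U \<phi> T J \<pi> Q)"
proof -
  let ?f = "stage_obj M c0 U \<phi> T J"
  define V where "V \<pi> = (INF Q\<in>quantizers_c M. ?f \<pi> Q)" for \<pi>
  obtain B where B: "\<And>\<mu>. \<mu> \<in> dens_class C C1 \<Longrightarrow> 0 \<le> J \<mu>" "\<And>\<mu>. \<mu> \<in> dens_class C C1 \<Longrightarrow> J \<mu> \<le> B"
    using J unfolding regular_value_def by blast
  have prob: "\<mu> \<in> space (prob_algebra borel)" if "\<mu> \<in> dens_class C C1" for \<mu> :: "'a measure"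
    using that dens_class_prob by blast
  have attained: "\<exists>Q\<in>quantizers_c M. V \<mu> = ?f \<mu> Q" if "\<mu> \<in> dens_class C C1" for \<mu>
    unfolding V_def by (rule stage_obj_INF_attained[OF J prob[OF that]])
  have V_le: "V \<mu> \<le> ?f \<mu> Q" if "\<mu> \<in> dens_class C C1" "Q \<in> quantizers_c M" for \<mu> Q
    unfolding V_def by (rule stage_obj_INF_le[OF J prob[OF that(1)] that(2)])
  have bounds: "0 \<le> V \<mu> \<and> V \<mu> \<le> (1 / real T) * (real M * K) + real M * \<bar>B\<bar>" if \<mu>: "\<mu> \<in> dens_class C C1" for \<mu>
  proof -
    obtain Q where Q: "Q \<in> quantizers_c M" "V \<mu> = ?f \<mu> Q" using attained[OF \<mu>] by blast
    show ?thesis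
      unfolding Q(2)
      using stage_obj_bounds[OF prob[OF \<mu>] quantizers_c_measurable[OF Q(1)], of J B] B by blast
  qed
  have cont: "(\<lambda>n. V (\<mu>s n)) \<longlonglongrightarrow> V \<mu>"
    if \<mu>: "\<mu> \<in> dens_class C C1" and \<mu>s: "\<And>n. \<mu>s n \<in> dens_class C C1" and tv: "tv_conv \<mu>s \<mu>" for \<mu>s \<mu>
  proof (rule ccontr)
    assume "\<not> (\<lambda>n. V (\<mu>s n)) \<longlonglongrightarrow> V \<mu>"
    then obtain e where e: "0 < e" "\<not> (\<forall>\<^sub>F n in sequentially. dist (V (\<mu>s n)) (V \<mu>) < e)"
      unfolding tendsto_iff by blast
    then obtain s :: "nat \<Rightarrow> nat" where s: "strict_mono s" "\<And>n. \<not> dist (V (\<mu>s (s n))) (V \<mu>) < e"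
      using not_eventually_sequentiallyD by blast
    have "\<forall>n. \<exists>Q. Q \<in> quantizers_c M \<and> V (\<mu>s (s n)) = ?f (\<mu>s (s n)) Q"
      using attained[OF \<mu>s] by blast
    then obtain Qs where Qs: "\<And>n. Qs n \<in> quantizers_c M" "\<And>n. V (\<mu>s (s n)) = ?f (\<mu>s (s n)) (Qs n)"
      unfolding choice_iff by blast
    obtain r Q where r: "strict_mono r" and Q: "Q \<in> quantizers_c M"
      and lim: "\<And>x. \<forall>\<^sub>F n in sequentially. Qs (r n) x = Q x"
      using quantizers_c_subsequence[of Qs, OF Qs(1)] by blast
    obtain Q' where Q': "Q' \<in> quantizers_c M" "V \<mu> = ?f \<mu> Q'" using attained[OF \<mu>] by blast
    have tv': "tv_conv (\<lambda>n. \<mu>s (s (r n))) \<mu>"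
      using tv_conv_subseq[OF tv_conv_subseq[OF tv s(1)] r] .
    have 1: "(\<lambda>n. V (\<mu>s (s (r n)))) \<longlonglongrightarrow> ?f \<mu> Q"
      unfolding Qs(2)
      by (intro stage_obj_tendsto[OF J prob[OF \<mu>] prob[OF \<mu>s] tv' quantizers_c_measurable[OF Q]
            quantizers_c_measurable[OF Qs(1)] lim])
    have 2: "(\<lambda>n. ?f (\<mu>s (s (r n))) Q') \<longlonglongrightarrow> V \<mu>"
      unfolding Q'(2)
      by (intro stage_obj_tendsto[OF J prob[OF \<mu>] prob[OF \<mu>s] tv' quantizers_c_measurable[OF Q'(1)]
            quantizers_c_measurable[OF Q'(1)]]) simp
    \<comment> \<open>\<open>Q'\<close> competes at every \<open>\<mu>s (s (r n))\<close>, so the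
      value there is at most its objective; both sides converge.\<close>
    have "?f \<mu> Q \<le> V \<mu>"
      using V_le[OF \<mu>s Q'(1)] by (intro LIMSEQ_le[OF 1 2]) auto
    then have "?f \<mu> Q = V \<mu>" using V_le[OF \<mu> Q] by linarith
    then have "\<forall>\<^sub>F n in sequentially. dist (V (\<mu>s (s (r n)))) (V \<mu>) < e"
      using 1 e(1) by (auto dest: tendstoD)
    then show False using s(2) by simp
  qed
  have "regular_value V" unfolding regular_value_def using bounds cont by blast
  then show ?thesis unfolding V_def .
qed

lemma regular_value_Jrem: "regular_value (Jrem M c0 U \<phi> T n)"
proof (induction n)
  case 0
  show ?case by (auto simp: regular_value_def)
next
  case (Suc n)
  then show ?case by (simp add: regular_value_stage)
qed

lemma Jrem_Suc_attained:
  assumes "\<pi> \<in> space (prob_algebra borel)"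
  shows "\<exists>Q\<in>quantizers_c M. Jrem M c0 U \<phi> T (Suc n) \<pi> = stage_obj M c0 U \<phi> T (Jrem M c0 U \<phi> T n) \<pi> Q"
  using stage_obj_INF_attained[OF regular_value_Jrem assms] by simp

lemma Jrem_weakly_continuous:
  assumes "\<pi> \<in> dens_class C C1" "\<And>k. \<pi>s k \<in> dens_class C C1" "weak_conv_seq \<pi>s \<pi>"
  shows "(\<lambda>k. Jrem M c0 U \<phi> T n (\<pi>s k)) \<longlonglongrightarrow> Jrem M c0 U \<phi> T n \<pi>"
  using regular_value_Jrem[of n] weak_conv_imp_tv_conv[OF assms(1,2) C1_nonneg assms(3)] assms(1,2)
  unfolding regular_value_def by blast

end

section \<open>Passing from the source to its transition density\<close>

text \<open>Joint measurability is not part of the hypotheses; it holds because \<open>\<phi> x z\<close> is the limit of the averages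
  of the law of \<open>f x\<close> against tents shrinking to \<open>z\<close>, which are jointly measurable.\<close>

lemma lipschitz_kernel_density_measurable:
  fixes f :: "'a::euclidean_space \<Rightarrow> 'a \<Rightarrow> 'a"
  assumes W: "prob_space W" "sets W = sets borel"
    and f: "(\<lambda>(x, w). f x w) \<in> borel_measurable (borel \<Otimes>\<^sub>M borel)"
    and law: "\<And>x. distr W borel (f x) = density lborel (\<lambda>z. ennreal (\<phi> x z))"
    and \<phi>: "\<And>x z. 0 \<le> \<phi> x z" "\<And>x z. \<phi> x z \<le> C" "\<And>x z z'. \<bar>\<phi> x z - \<phi> x z'\<bar> \<le> C1 * dist z z'"
    and C1: "0 \<le> C1"
  shows "(\<lambda>(x, z). \<phi> x z) \<in> borel_measurable (borel \<Otimes>\<^sub>M borel)"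
proof -
  interpret prob_space W by (rule W(1))
  note [measurable] = f
  note [measurable_cong] = W(2)
  have \<phi>_meas [measurable]: "\<phi> x \<in> borel_measurable borel" for x
  proof (rule borel_measurable_continuous_onI)
    have "C1-lipschitz_on UNIV (\<phi> x)"
      using \<phi>(3) C1 by (intro lipschitz_onI) (auto simp: dist_real_def)
    then show "continuous_on UNIV (\<phi> x)" by (rule lipschitz_on_continuous_on)
  qed
  define \<rho> where "\<rho> n = inverse (real (Suc n))" for n
  \<comment> \<open>Written through \<open>f\<close> and \<open>W\<close>, the average is jointly
    measurable in \<open>x\<close> and \<open>z\<close>; rewritten by \<open>A_eq\<close> as an
    average of \<open>\<phi> x\<close>, it is within \<open>C1 * \<rho> n\<close> of
    \<open>\<phi> x z\<close>.\<close>
  define A where "A n x z = (\<integral>w. tent (\<rho> n) z (f x w) \<partial>W) / (\<integral>y. tent (\<rho> n) z y \<partial>lborel)" for n x z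
  have A_eq: "A n x z = (\<integral>y. tent (\<rho> n) z y * \<phi> x y \<partial>lborel) / (\<integral>y. tent (\<rho> n) z y \<partial>lborel)" for n x z
  proof -
    have "(\<integral>w. tent (\<rho> n) z (f x w) \<partial>W) = (\<integral>y. tent (\<rho> n) z y \<partial>distr W borel (f x))"
      by (subst integral_distr) auto
    also have "\<dots> = (\<integral>y. tent (\<rho> n) z y * \<phi> x y \<partial>lborel)"
      unfolding law using \<phi>(1) by (subst integral_density) (auto simp: mult.commute)
    finally show ?thesis by (simp add: A_def)
  qed
  show ?thesis
  proof (rule borel_measurable_LIMSEQ_real)
    show "(\<lambda>(x, z). A n x z) \<in> borel_measurable (borel \<Otimes>\<^sub>M borel)" for n
      unfolding A_def by measurable
    fix p :: "'a \<times> 'a"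
    obtain x z where p: "p = (x, z)" by fastforce
    have "norm (A n x z - \<phi> x z) \<le> C1 * \<rho> n" for n
      unfolding A_eq real_norm_def using \<phi> C1 by (intro tent_average_lipschitz[where B = C]) (auto simp: \<rho>_def)
    then have "\<forall>\<^sub>F n in sequentially. norm (A n x z - \<phi> x z) \<le> C1 * \<rho> n" by simp
    moreover have "(\<lambda>n. C1 * \<rho> n) \<longlonglongrightarrow> 0"
      using tendsto_mult_left[OF LIMSEQ_inverse_real_of_nat, of C1] by (simp add: \<rho>_def)
    ultimately have "(\<lambda>n. A n x z - \<phi> x z) \<longlonglongrightarrow> 0"
      by (rule Lim_null_comparison)
    then have "(\<lambda>n. A n x z) \<longlonglongrightarrow> \<phi> x z" by (rule LIM_zero_cancel)
    then show "(\<lambda>n. case p of (x, z) \<Rightarrow> A n x z) \<longlonglongrightarrow> (case p of (x, z) \<Rightarrow> \<phi> x z)"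
      by (simp add: p)
  qed
qed

theorem theorem10:
  fixes f :: "'a::euclidean_space \<Rightarrow> 'a \<Rightarrow> 'a" and W :: "'a measure"
    and \<phi> :: "'a \<Rightarrow> 'a \<Rightarrow> real" and C C1 :: real
    and c0 :: "'a \<Rightarrow> 'u::metric_space \<Rightarrow> real" and U :: "'u set"
    and M T :: nat and \<pi>0 :: "'a measure"
  assumes W: "prob_space W" "sets W = sets borel"
    and f_meas: "(\<lambda>(x, w). f x w) \<in> borel_measurable (borel \<Otimes>\<^sub>M borel)"
    and f_law: "\<forall>x. distr W borel (f x) = density lborel (\<lambda>z. ennreal (\<phi> x z))"
    and \<phi>_pos: "\<forall>x z. 0 < \<phi> x z"
    and \<phi>_bdd: "\<forall>x z. \<phi> x z \<le> C"
    and \<phi>_lip: "\<forall>x z z'. \<bar>\<phi> x z - \<phi> x z'\<bar> \<le> C1 * dist z z'"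
    and c0_nonneg: "\<forall>x. \<forall>u\<in>U. 0 \<le> c0 x u"
    and c0_bdd: "bounded ((\<lambda>(x, u). c0 x u) ` (UNIV \<times> U))"
    and c0_cont: "continuous_on (UNIV \<times> U) (\<lambda>(x, u). c0 x u)"
    and U: "compact U" "U \<noteq> {}"
    and M: "M \<ge> 1"
    and T: "T \<ge> 1"
    and \<pi>0: "prob_space \<pi>0" "sets \<pi>0 = sets borel"
      "(\<exists>g. g \<in> borel_measurable lborel \<and> \<pi>0 = density lborel g) \<or> (\<exists>x0. \<pi>0 = return borel x0)"
  shows "(\<forall>t\<in>{1..<T}. \<forall>\<pi>\<in>dens_class C C1. \<exists>Q\<in>quantizers_c M.
            JT M c0 U \<phi> T t \<pi> = stage_obj M c0 U \<phi> T (JT M c0 U \<phi> T (t + 1)) \<pi> Q)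
       \<and> (\<forall>\<pi>\<in>dens_class C C1 \<union> {\<pi>0}. \<exists>Q\<in>quantizers_c M.
            JT M c0 U \<phi> T 0 \<pi> = stage_obj M c0 U \<phi> T (JT M c0 U \<phi> T 1) \<pi> Q)
       \<and> (\<forall>t\<le>T. \<forall>\<pi>\<in>dens_class C C1. \<forall>\<pi>s.
            (\<forall>n. \<pi>s n \<in> dens_class C C1) \<and> weak_conv_seq \<pi>s \<pi> \<longrightarrow>
            (\<lambda>n. JT M c0 U \<phi> T t (\<pi>s n)) \<longlonglongrightarrow> JT M c0 U \<phi> T t \<pi>)"
proof -
  have C: "0 < C" using \<phi>_pos \<phi>_bdd by (meson less_le_trans)
  have C1: "0 \<le> C1"
  proof -
    \<comment> \<open>The Lipschitz bound at two distinct points, here a basis vector and 0, forces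
      the sign of \<open>C1\<close>.\<close>
    obtain b :: 'a where "b \<in> Basis" using nonempty_Basis by blast
    then have "b \<noteq> 0" by (rule nonzero_Basis)
    moreover have "0 \<le> C1 * dist b 0" using \<phi>_lip by (meson abs_ge_zero order_trans)
    ultimately show ?thesis by (simp add: zero_le_mult_iff)
  qed
  have \<phi>_measurable: "(\<lambda>(x, z). \<phi> x z) \<in> borel_measurable (borel \<Otimes>\<^sub>M borel)"
    using f_law \<phi>_pos \<phi>_bdd \<phi>_lip C1
    by (intro lipschitz_kernel_density_measurable[OF W f_meas]) (auto intro: less_imp_le)
  have \<phi>_mass: "(\<integral>\<^sup>+z. ennreal (\<phi> x z) \<partial>lborel) = 1" for x
  proof -
    interpret prob_space W by (rule W(1))
    note [measurable] = f_meas \<phi>_measurable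
    note [measurable_cong] = W(2)
    interpret D: prob_space "distr W borel (f x)" by (rule prob_space_distr) measurable
    show ?thesis
      using D.emeasure_space_1 f_law by (simp add: emeasure_density)
  qed
  obtain K where K: "0 < K" "\<And>x u. u \<in> U \<Longrightarrow> \<bar>c0 x u\<bar> \<le> K"
    using c0_bdd unfolding bounded_pos by force
  have c0_measurable: "(\<lambda>x. c0 x u) \<in> borel_measurable borel" if "u \<in> U" for u
  proof (rule borel_measurable_continuous_onI)
    have "continuous_on UNIV ((\<lambda>(x, u). c0 x u) \<circ> (\<lambda>x. (x, u)))"
      using that by (intro continuous_on_compose continuous_intros continuous_on_subset[OF c0_cont]) auto
    then show "continuous_on UNIV (\<lambda>x. c0 x u)" by (simp add: o_def)
  qed
  interpret quantized_control \<phi> C C1 c0 U K M T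
  proof
    show "0 \<le> \<phi> x z" for x z using \<phi>_pos by (simp add: less_imp_le)
    show "c0 x u \<le> K" if "u \<in> U" for x u using K(2)[OF that] by (rule abs_le_D1)
  qed (use \<phi>_measurable \<phi>_mass \<phi>_bdd \<phi>_lip C1 C c0_measurable c0_nonneg K(1) U(2) M in auto)
  have attained: "\<exists>Q\<in>quantizers_c M. JT M c0 U \<phi> T t \<pi> = stage_obj M c0 U \<phi> T (JT M c0 U \<phi> T (t + 1)) \<pi> Q"
    if "t < T" "\<pi> \<in> space (prob_algebra borel)" for t \<pi>
    \<comment> \<open>\<open>Jrem\<close> counts the remaining stages: for \<open>t < T\<close> the
      number \<open>T - t\<close> is the successor of \<open>T - (t + 1)\<close>, so one unfolding
      of \<open>Jrem\<close> is the step from \<open>t + 1\<close> to \<open>t\<close>.\<close>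
    using Jrem_Suc_attained[OF that(2), of "T - (t + 1)"] that(1) by (simp add: JT_def Suc_diff_Suc)
  have prob: "\<pi> \<in> space (prob_algebra borel)" if "\<pi> \<in> dens_class C C1 \<union> {\<pi>0}" for \<pi>
    using that dens_class_prob \<pi>0(1,2) by (auto simp: space_prob_algebra)
  have "\<forall>t\<in>{1..<T}. \<forall>\<pi>\<in>dens_class C C1. \<exists>Q\<in>quantizers_c M.
      JT M c0 U \<phi> T t \<pi> = stage_obj M c0 U \<phi> T (JT M c0 U \<phi> T (t + 1)) \<pi> Q"
    using attained prob by simp
  moreover have "\<forall>\<pi>\<in>dens_class C C1 \<union> {\<pi>0}. \<exists>Q\<in>quantizers_c M.
      JT M c0 U \<phi> T 0 \<pi> = stage_obj M c0 U \<phi> T (JT M c0 U \<phi> T 1) \<pi> Q"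
    using attained[of 0] prob T by simp
  moreover have "\<forall>t\<le>T. \<forall>\<pi>\<in>dens_class C C1. \<forall>\<pi>s.
      (\<forall>n. \<pi>s n \<in> dens_class C C1) \<and> weak_conv_seq \<pi>s \<pi> \<longrightarrow>
      (\<lambda>n. JT M c0 U \<phi> T t (\<pi>s n)) \<longlonglongrightarrow> JT M c0 U \<phi> T t \<pi>"
    unfolding JT_def using Jrem_weakly_continuous by blast
  ultimately show ?thesis by blast
qed

end
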